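(* Let $D$ be a Dedekind domain and let $H$ be a congruence subgroup of $SL_2(D)$ whose level $l(H)=\mathfrak{q}$ satisfies Condition L. Then $$ql(H)=l(H).$$ In other words, the quasi-level of $H$ is then automatically an ideal of $D$.
   Context: Dedekind domains are integrally closed Noetherian domains of Krull dimension one (so not fields). For $r\in D$ put $T(r)=\begin{pmatrix}1&r\\0&1\end{pmatrix}$. For an ideal $\mathfrak{q}$ of $D$, $SL_2(D,\mathfrak{q})=\{X\in SL_2(D): X\equiv I_2 \pmod{\mathfrak{q}}\}$. A subgroup $H$ of $SL_2(D)$ is a congruence subgroup if $SL_2(D,\mathfrak{q}')\le H$ for some non-zero ideal $\mathfrak{q}'$ of $D$. The quasi-level $ql(H)$ is the set of all $r\in D$ such that $T(r)$ lies in every conjugate of $H$ in $SL_2(D)$ (an additive subgroup of $D$). The level $l(H)$ is the largest ideal of $D$ contained in $ql(H)$, i.e. the largest ideal $\mathfrak{q}$ such that for all $r\in\mathfrak{q}$ the matrix $T(r)$ lies in every conjugate of $H$ in $SL_2(D)$. Condition L for a subgroup $H$ of non-zero level $\mathfrak{q}=l(H)$: (i) $\mathfrak{q}+(2)=D$; and (ii) there are no prime ideals $\mathfrak{p}$ of $D$ for which $|D/\mathfrak{p}|=3$ and $\mathrm{ord}_{\mathfrak{p}}(\mathfrak{q})=1$, where $\mathrm{ord}_{\mathfrak{p}}(\mathfrak{q})$ is the exponent of $\mathfrak{p}$ in the prime factorization of $\mathfrak{q}$. *)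

theory Defs
  imports
    "HOL-Analysis.Determinants"
    "HOL-Computational_Algebra.Polynomial_Factorial"
    "HOL-Library.Extended_Nat"
    "HOL-Algebra.Algebraic_Closure_Type"
    "HOL-Algebra.Ideal_Product"
    "HOL-Algebra.Ring_Divisibility"
begin

text \<open>
  The base ring is a type of class \<open>idom\<close>. Its ideals, prime ideals and quotients are those of
  the associated ring record.
\<close>

abbreviation type_ring :: "'a::idom ring" (\<open>\<D>\<close>)
  where "\<D> \<equiv> ring_of_type_algebra"

unbundle no fps_syntax

section \<open>Dedekind domains\<close>

definition krull_dim :: "('a, 'b) ring_scheme \<Rightarrow> enat"
  where "krull_dim R =
    (SUP n \<in> {n. \<exists>P. (\<forall>i\<le>n. primeideal (P i) R) \<and> (\<forall>i<n. P i \<subset> P (Suc i))}. enat n)"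

definition integral_over_base :: "'a::idom fract \<Rightarrow> bool"
  where "integral_over_base x \<longleftrightarrow>
    (\<exists>p::'a poly. lead_coeff p = 1 \<and> poly (map_poly to_fract p) x = 0)"

definition integrally_closed_domain :: "'a::idom itself \<Rightarrow> bool"
  where "integrally_closed_domain _ \<longleftrightarrow>
    (\<forall>x::'a fract. integral_over_base x \<longrightarrow> x \<in> range to_fract)"

definition dedekind_domain :: "'a::idom itself \<Rightarrow> bool"
  where "dedekind_domain T \<longleftrightarrow>
    integrally_closed_domain T \<and> noetherian_domain (\<D> :: 'a ring) \<and> krull_dim (\<D> :: 'a ring) = 1"

text \<open>
  The function \<open>e\<close> is the family of exponents of the prime factorization of \<open>\<qq>\<close>. In a Dedekind
  domain it exists and is unique for every non-zero ideal \<open>\<qq>\<close>; otherwise the value is unspecified.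
\<close>

definition ord_ideal :: "'a::idom set \<Rightarrow> 'a set \<Rightarrow> nat"
  where "ord_ideal \<pp> \<qq> =
    (THE e. finite {P. e P \<noteq> 0} \<and>
            (\<forall>P. e P \<noteq> 0 \<longrightarrow> primeideal P \<D> \<and> P \<noteq> {0}) \<and>
            \<qq> = finprod (ideals_set \<D>) (\<lambda>P. P [^]\<^bsub>ideals_set \<D>\<^esub> (e P :: nat)) {P. e P \<noteq> 0}) \<pp>"

section \<open>Subgroups of the special linear group\<close>

definition SL2 :: "('a::comm_ring_1 ^ 2 ^ 2) monoid"
  where "SL2 = \<lparr>carrier = {A. det A = 1}, monoid.mult = (\<lambda>A B. A ** B), one = mat 1\<rparr>"

definition T_mat :: "'a::comm_ring_1 \<Rightarrow> 'a ^ 2 ^ 2"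
  where "T_mat r = vector [vector [1, r], vector [0, 1]]"

definition SL2_principal :: "'a::comm_ring_1 set \<Rightarrow> ('a ^ 2 ^ 2) set"
  where "SL2_principal \<qq> = {A \<in> carrier SL2. \<forall>i j. A $ i $ j - mat 1 $ i $ j \<in> \<qq>}"

definition congruence_subgroup :: "('a::idom ^ 2 ^ 2) set \<Rightarrow> bool"
  where "congruence_subgroup H \<longleftrightarrow>
    subgroup H SL2 \<and> (\<exists>\<qq>. ideal \<qq> \<D> \<and> \<qq> \<noteq> {0} \<and> SL2_principal \<qq> \<subseteq> H)"

definition quasi_level :: "('a::comm_ring_1 ^ 2 ^ 2) set \<Rightarrow> 'a set"
  where "quasi_level H =
    {r. \<forall>g\<in>carrier SL2. T_mat r \<in> (g <#\<^bsub>SL2\<^esub> H) #>\<^bsub>SL2\<^esub> inv\<^bsub>SL2\<^esub> g}"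

text \<open>\<open>GREATEST\<close> refers to inclusion of sets.\<close>

definition level :: "('a::idom ^ 2 ^ 2) set \<Rightarrow> 'a set"
  where "level H = (GREATEST \<qq>. ideal \<qq> \<D> \<and> \<qq> \<subseteq> quasi_level H)"

definition condition_L :: "('a::idom ^ 2 ^ 2) set \<Rightarrow> bool"
  where "condition_L H \<longleftrightarrow>
    level H \<noteq> {0} \<and>
    level H <+>\<^bsub>\<D>\<^esub> PIdl\<^bsub>\<D>\<^esub> 2 = carrier \<D> \<and>
    \<not> (\<exists>\<pp>. primeideal \<pp> \<D> \<and> card (carrier (\<D> Quot \<pp>)) = 3 \<and> ord_ideal \<pp> (level H) = 1)"

end

theory Submission
  imports Defs
begin

text \<open>
  Pass to the normal core N of H, let Q be the quasi-level and q the level. Since N contains some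
  principal congruence subgroup of level q', a semilocal argument modulo q' shows that N contains
  the one of level q. Conjugation by lifts of diag(u, 1/u) modulo q makes Q stable under squares of
  units modulo q, hence under 4 x = (x + 1)^2 - (x - 1)^2 whenever x + 1 and x - 1 are units. As 2 is
  a unit modulo q, Q is stable under the ideal J of elements lying in all primes over q with residue
  field of three elements: at the other primes the residue field has at least five elements, so
  every x is a sum of two such elements. Thus J r lies in q for r in Q. Since q has order at least
  two at the primes with residue field of three elements, this forces r to lie in J, so r^2 and 3 r
  lie in q, and N acts to first order on r times traceless matrices. Three commutators then put
  d^2 r in Q for every d, and 4 d r = ((d + 1)^2 - (d - 1)^2) r gives d r in Q.
\<close>

section \<open>Ideals as submodules of the ring type\<close>

text \<open>Order one at primes of norm three is the obstacle behind Condition L. \<open>SL2\<close>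
  over the field of three elements has a quotient of order three in which \<open>T(1)\<close>
  survives. If \<open>P1\<close> and \<open>P2\<close> are two such primes, the matrices on which
  the two resulting characters agree form a normal congruence subgroup of level
  \<open>P1 P2\<close>, whose quasi-level consists of all \<open>r\<close> with the same residue at
  both primes and is not an ideal. Squares of units are no help there, since all of them are 1
  modulo such a prime; so units only provide multipliers in J. Order at least two excludes this
  behaviour: if \<open>r\<close> were a unit at such a prime P, then J r inside \<open>P^2\<close>
  would force \<open>P = P^2\<close>. Once \<open>r\<close> is in J, its square is in J r and hence
  in q, which removes the second-order terms and leaves linear algebra on traceless matrices. The
  constants work out because 3 is in J: on \<open>r\<close>, the factor -2 produced by the
  commutators acts like 1, and so does the factor 4 of the difference of squares.\<close>

interpretation ring_mod: Modules.module "(*) :: 'a::comm_ring_1 \<Rightarrow> 'a \<Rightarrow> 'a"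
  by unfold_locales (simp_all add: algebra_simps)

text \<open>With multiplication as scaling, this rule reassociates products to the left and would
  loop against \<open>mult.assoc\<close>.\<close>

declare ring_mod.scale_scale [simp del]

text \<open>Viewing the ring as a module over itself supplies spans, intersections and closure rules
  for ideals; \<open>ideal_iff\<close> and \<open>primeideal_iff\<close> connect this view with the
  ring records of the definitions.\<close>

abbreviation is_ideal :: "'a::comm_ring_1 set \<Rightarrow> bool"
  where "is_ideal \<equiv> ring_mod.subspace"

abbreviation ideal_span :: "'a::comm_ring_1 set \<Rightarrow> 'a set"
  where "ideal_span \<equiv> ring_mod.span"

definition is_prime :: "'a::comm_ring_1 set \<Rightarrow> bool"
  where "is_prime P \<longleftrightarrow> is_ideal P \<and> 1 \<notin> P \<and> (\<forall>a b. a * b \<in> P \<longrightarrow> a \<in> P \<or> b \<in> P)"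

lemma type_ring_simps [simp]:
  "carrier (\<D> :: 'a::idom ring) = UNIV"
  "monoid.mult (\<D> :: 'a ring) = (*)"
  "monoid.one (\<D> :: 'a ring) = 1"
  "ring.add (\<D> :: 'a ring) = (+)"
  "ring.zero (\<D> :: 'a ring) = 0"
  by (auto simp: ring_of_type_algebra_def)

interpretation type_ring: cring "\<D> :: 'a::idom ring"
  by (rule cring_from_type_algebra)

lemma a_inv_type_ring: "a_inv (\<D> :: 'a::idom ring) x = - x"
  using type_ring.l_neg[of x] by (simp add: eq_neg_iff_add_eq_0)

lemma ideal_iff: "ideal I (\<D> :: 'a::idom ring) \<longleftrightarrow> is_ideal I"
proof
  assume "ideal I (\<D> :: 'a ring)"
  then interpret I: ideal I "\<D> :: 'a ring" .
  show "is_ideal I"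
    unfolding ring_mod.subspace_def
    using I.zero_closed I.a_closed I.I_l_closed by simp
next
  assume I: "is_ideal I"
  show "ideal I (\<D> :: 'a ring)"
  proof (rule idealI)
    show "ring (\<D> :: 'a ring)" by (rule type_ring.ring_axioms)
    have "inv\<^bsub>add_monoid \<D>\<^esub> x = - x" for x :: 'a
      using a_inv_type_ring[of x] by (simp add: a_inv_def)
    then show "subgroup I (add_monoid (\<D> :: 'a ring))"
      using I ring_mod.subspace_add[OF I] ring_mod.subspace_0[OF I] ring_mod.subspace_neg[OF I]
      by (simp add: subgroup_def)
  qed (use ring_mod.subspace_scale[OF I] in \<open>simp_all add: mult.commute\<close>)
qed

lemma primeideal_iff: "primeideal P (\<D> :: 'a::idom ring) \<longleftrightarrow> is_prime P"
proof
  assume "primeideal P (\<D> :: 'a ring)"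
  then interpret P: primeideal P "\<D> :: 'a ring" .
  have "1 \<notin> P"
    using P.one_imp_carrier P.I_notcarr by auto
  then show "is_prime P"
    using P.I_prime P.is_ideal by (simp add: is_prime_def ideal_iff)
next
  assume P: "is_prime P"
  show "primeideal P (\<D> :: 'a ring)"
    by (rule primeidealI) (use P type_ring.is_cring in \<open>auto simp: is_prime_def ideal_iff\<close>)
qed

lemma is_ideal_add_multiples:
  assumes "is_ideal I"
  shows "is_ideal {x + a * c | x c. x \<in> I}"
proof -
  have "ideal_span (insert a I) = {x + a * c | x c. x \<in> I}"
    using assms unfolding ring_mod.span_insert
    by (auto simp: algebra_simps ring_mod.span_eq_iff[THEN iffD2]; metis diff_add_cancel add_diff_cancel_right' mult.commute)
  then show ?thesis
    by (metis ring_mod.subspace_span)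
qed

lemma is_ideal_quotient:
  assumes "is_ideal I"
  shows "is_ideal {x. a * x \<in> I}"
proof (rule ring_mod.subspaceI)
  show "0 \<in> {x. a * x \<in> I}"
    using ring_mod.subspace_0[OF assms] by simp
  show "x + y \<in> {x. a * x \<in> I}" if "x \<in> {x. a * x \<in> I}" "y \<in> {x. a * x \<in> I}" for x y
    using that ring_mod.subspace_add[OF assms] by (simp add: distrib_left)
  show "c * x \<in> {x. a * x \<in> I}" if "x \<in> {x. a * x \<in> I}" for c x
    using that ring_mod.subspace_scale[OF assms, of "a * x" c] by (simp add: mult.left_commute)
qed

lemma is_ideal_colon:
  assumes "is_ideal I"
  shows "is_ideal {x. \<forall>y\<in>A. x * y \<in> I}"
proof -
  have "{x. \<forall>y\<in>A. x * y \<in> I} = \<Inter> ((\<lambda>y. {x. y * x \<in> I}) ` A)"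
    by (auto simp: mult.commute)
  moreover have "is_ideal (\<Inter> ((\<lambda>y. {x. y * x \<in> I}) ` A))"
    by (rule ring_mod.subspace_Inter) (use is_ideal_quotient[OF assms] in blast)
  ultimately show ?thesis
    by (simp only:)
qed

lemma is_ideal_principal: "is_ideal {x::'a::comm_ring_1. a dvd x}"
  by (rule ring_mod.subspaceI) simp_all

section \<open>Products of ideals\<close>

abbreviation ideal_times :: "'a::idom set \<Rightarrow> 'a set \<Rightarrow> 'a set"  (infixl \<open>\<star>\<close> 70)
  where "I \<star> J \<equiv> ideal_prod \<D> I J"

lemma is_ideal_times: "is_ideal I \<Longrightarrow> is_ideal J \<Longrightarrow> is_ideal (I \<star> J)"
  using type_ring.ideal_prod_is_ideal by (simp add: ideal_iff)

lemma times_mem: "x \<in> I \<Longrightarrow> y \<in> J \<Longrightarrow> x * y \<in> I \<star> J"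
  using ideal_prod.prod[of x I y J "\<D>"] by simp

lemma times_subsetI:
  assumes "is_ideal K" "\<And>x y. x \<in> I \<Longrightarrow> y \<in> J \<Longrightarrow> x * y \<in> K"
  shows "I \<star> J \<subseteq> K"
proof
  fix z assume "z \<in> I \<star> J"
  then show "z \<in> K"
    by induction (use assms ring_mod.subspace_add in auto)
qed

lemma times_mono:
  assumes "is_ideal I'" "is_ideal J'" "I \<subseteq> I'" "J \<subseteq> J'"
  shows "I \<star> J \<subseteq> I' \<star> J'"
  using assms by (intro times_subsetI is_ideal_times) (auto intro: times_mem)

lemma times_commute: "is_ideal I \<Longrightarrow> is_ideal J \<Longrightarrow> I \<star> J = J \<star> I"
  using type_ring.ideal_prod_commute by (simp add: ideal_iff)

lemma times_assoc: "is_ideal I \<Longrightarrow> is_ideal J \<Longrightarrow> is_ideal K \<Longrightarrow> I \<star> J \<star> K = I \<star> (J \<star> K)"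
  using type_ring.ideal_prod_assoc by (simp add: ideal_iff)

lemma times_subset_left: "is_ideal I \<Longrightarrow> I \<star> J \<subseteq> I"
  by (rule times_subsetI) (use ring_mod.subspace_scale in \<open>auto simp: mult.commute\<close>)

lemma times_UNIV: "is_ideal I \<Longrightarrow> I \<star> UNIV = I"
  using times_subset_left[of I UNIV] times_mem[of _ I 1 UNIV] by auto

lemma UNIV_times: "is_ideal I \<Longrightarrow> UNIV \<star> I = I"
  by (metis times_UNIV times_commute ring_mod.subspace_UNIV)

lemma is_prime_times_subset:
  assumes "is_prime P" "I \<star> J \<subseteq> P"
  shows "I \<subseteq> P \<or> J \<subseteq> P"
proof (rule disjCI)
  assume "\<not> J \<subseteq> P"
  then obtain y where "y \<in> J" "y \<notin> P"
    by blast
  then have "x \<in> P" if "x \<in> I" for x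
    using that assms times_mem[of x I y J] unfolding is_prime_def by blast
  then show "I \<subseteq> P"
    by blast
qed

lemma one_mem_ideal: "is_ideal I \<Longrightarrow> 1 \<in> I \<Longrightarrow> I = UNIV"
  using ring_mod.subspace_scale[of I 1] by auto

section \<open>Dedekind domains\<close>

locale dedekind =
  fixes type_of_ring :: "'a::idom itself"
  assumes dedekind: "dedekind_domain type_of_ring"
begin

sublocale noeth: noetherian_domain "\<D> :: 'a ring"
  using dedekind by (simp add: dedekind_domain_def)

lemma ideal_chain_Union:
  assumes "C \<noteq> {}" "\<And>I. I \<in> C \<Longrightarrow> is_ideal (I :: 'a set)" "\<And>I J. I \<in> C \<Longrightarrow> J \<in> C \<Longrightarrow> I \<subseteq> J \<or> J \<subseteq> I"
  shows "\<Union>C \<in> C"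
  by (rule noeth.ideal_chain_is_trivial) (use assms in \<open>auto simp: subset_chain_def ideal_iff\<close>)

lemma maximal_ideal_exists:
  assumes "S \<noteq> {}" "\<And>I. I \<in> S \<Longrightarrow> is_ideal (I :: 'a set)"
  obtains M where "M \<in> S" "\<And>I. I \<in> S \<Longrightarrow> M \<subseteq> I \<Longrightarrow> I = M"
proof -
  have "\<exists>M \<in> S. \<forall>J \<in> S. M \<subseteq> J \<longrightarrow> J = M"
  proof (rule subset_Zorn)
    fix C assume C: "subset.chain S C"
    show "\<exists>U\<in>S. \<forall>J\<in>C. J \<subseteq> U"
    proof (cases "C = {}")
      case False
      have "\<Union>C \<in> C"
        by (rule ideal_chain_Union[OF False]) (use C assms in \<open>auto simp: subset_chain_def\<close>)
      then show ?thesis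
        using C by (auto simp: subset_chain_def)
    qed (use assms in auto)
  qed
  then show ?thesis
    using that by auto
qed

text \<open>The induction descends from larger ideals: the ascending chain condition yields a
  maximal counterexample.\<close>

lemma noetherian_induct [consumes 1, case_names step]:
  assumes "is_ideal (I :: 'a set)"
    and step: "\<And>I. is_ideal I \<Longrightarrow> (\<And>J. is_ideal J \<Longrightarrow> I \<subset> J \<Longrightarrow> P J) \<Longrightarrow> P I"
  shows "P I"
proof (rule ccontr)
  assume "\<not> P I"
  then obtain M where "M \<in> {J. is_ideal J \<and> \<not> P J}"
    and "\<And>J. J \<in> {J. is_ideal J \<and> \<not> P J} \<Longrightarrow> M \<subseteq> J \<Longrightarrow> J = M"
    using maximal_ideal_exists[of "{J. is_ideal J \<and> \<not> P J}"] assms(1) by blast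
  then show False
    using step[of M] by blast
qed

text \<open>Krull dimension one enters here: a strict inclusion would give the chain
  \<open>{0}\<close>, \<open>P\<close>, \<open>M\<close> of length two.\<close>

lemma nonzero_prime_maximal:
  assumes P: "is_prime (P :: 'a set)" "P \<noteq> {0}" and M: "is_prime M" "P \<subseteq> M"
  shows "M = P"
proof (rule ccontr)
  assume "M \<noteq> P"
  define f where "f = (\<lambda>i::nat. if i = 0 then {0} else if i = 1 then P else M)"
  have "is_prime {0::'a}"
    by (simp add: is_prime_def)
  moreover have "{0} \<subset> P"
    using P ring_mod.subspace_0 by (auto simp: is_prime_def)
  ultimately have "(\<forall>i\<le>2. primeideal (f i) \<D>) \<and> (\<forall>i<2. f i \<subset> f (Suc i))"
    using P M \<open>M \<noteq> P\<close> by (auto simp: f_def primeideal_iff less_2_cases_iff)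
  then have "enat 2 \<le> krull_dim (\<D> :: 'a ring)"
    unfolding krull_dim_def by (intro SUP_upper) blast
  then show False
    using dedekind by (simp add: dedekind_domain_def one_enat_def)
qed

lemma maximal_is_prime:
  assumes M: "is_ideal (M :: 'a set)" "1 \<notin> M"
    and max: "\<And>J. is_ideal J \<Longrightarrow> 1 \<notin> J \<Longrightarrow> M \<subseteq> J \<Longrightarrow> J = M"
  shows "is_prime M"
proof -
  have "b \<in> M" if ab: "a * b \<in> M" and a: "a \<notin> M" for a b
  proof -
    define J where "J = {x + a * c | x c. x \<in> M}"
    have J: "is_ideal J"
      unfolding J_def by (rule is_ideal_add_multiples[OF M(1)])
    have "x + a * 0 \<in> J" if "x \<in> M" for x
      unfolding J_def using that by blast
    then have "M \<subseteq> J"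
      by auto
    moreover have "0 + a * 1 \<in> J"
      unfolding J_def using ring_mod.subspace_0[OF M(1)] by blast
    ultimately have "1 \<in> J"
      using max[OF J] a by auto
    then obtain x c where x: "x \<in> M" "1 = x + a * c"
      unfolding J_def by blast
    have "b * x + c * (a * b) = b * (x + a * c)"
      by (simp add: algebra_simps)
    also have "\<dots> = b"
      by (simp only: x(2)[symmetric] mult_1_right)
    finally show ?thesis
      using ring_mod.subspace_add[OF M(1)] ring_mod.subspace_scale[OF M(1)] ab x(1) by metis
  qed
  then show ?thesis
    using M by (auto simp: is_prime_def)
qed

lemma prime_over_ideal:
  assumes I: "is_ideal (I :: 'a set)" "1 \<notin> I"
  obtains P where "is_prime P" "I \<subseteq> P"
proof -
  obtain M where M: "M \<in> {J. is_ideal J \<and> 1 \<notin> J \<and> I \<subseteq> J}"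
    and max: "\<And>J. J \<in> {J. is_ideal J \<and> 1 \<notin> J \<and> I \<subseteq> J} \<Longrightarrow> M \<subseteq> J \<Longrightarrow> J = M"
    using maximal_ideal_exists[of "{J. is_ideal J \<and> 1 \<notin> J \<and> I \<subseteq> J}"] I by blast
  then have "is_prime M"
    by (intro maximal_is_prime) auto
  then show ?thesis
    using M that by auto
qed

text \<open>The ideal generated by \<open>I\<close> and \<open>u\<close> lies in no prime ideal, so
  it contains 1.\<close>

lemma unit_mod_ideal:
  assumes I: "is_ideal (I :: 'a set)" and u: "\<And>P. is_prime P \<Longrightarrow> I \<subseteq> P \<Longrightarrow> u \<notin> P"
  obtains v where "u * v - 1 \<in> I"
proof -
  define J where "J = {x + u * c | x c. x \<in> I}"
  have J: "is_ideal J"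
    unfolding J_def by (rule is_ideal_add_multiples[OF I])
  have "1 \<in> J"
  proof (rule ccontr)
    assume "1 \<notin> J"
    then obtain P where P: "is_prime P" "J \<subseteq> P"
      using prime_over_ideal[OF J] by blast
    have "x + u * 0 \<in> J" if "x \<in> I" for x
      unfolding J_def using that by blast
    then have "I \<subseteq> J"
      by auto
    moreover have "0 + u * 1 \<in> J"
      unfolding J_def using ring_mod.subspace_0[OF I] by blast
    ultimately show False
      using u P by auto
  qed
  then obtain x v where "x \<in> I" "1 = x + u * v"
    unfolding J_def by blast
  then have "u * v - 1 = - x"
    by (metis add_diff_cancel_right' minus_diff_eq)
  then show ?thesis
    using that[of v] ring_mod.subspace_neg[OF I \<open>x \<in> I\<close>] by simp
qed

text \<open>With x = c / a the ideals spanned by y, x y, ..., x^n y (for a fixed non-zero y in I)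
  become stationary, which gives an equation of integral dependence for x.\<close>

lemma dvd_if_scale_subset:
  assumes I: "is_ideal (I :: 'a set)" "I \<noteq> {0}" and a: "a \<noteq> 0"
    and sub: "\<And>x. x \<in> I \<Longrightarrow> \<exists>y\<in>I. c * x = a * y"
  shows "a dvd c"
proof -
  obtain y where y: "y \<in> I" "y \<noteq> 0"
    using I ring_mod.subspace_0 by blast
  obtain g where g: "\<And>x. x \<in> I \<Longrightarrow> g x \<in> I \<and> c * x = a * g x"
    using sub by metis
  define z where "z n = (g ^^ n) y" for n
  have z_I: "z n \<in> I" for n
    by (induction n) (use y g in \<open>auto simp: z_def\<close>)
  have z_Suc: "c * z n = a * z (Suc n)" for n
    using g[OF z_I[of n]] by (simp add: z_def)
  define x where "x = to_fract c / to_fract a"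
  have z_x: "to_fract (z n) = x ^ n * to_fract y" for n
  proof (induction n)
    case (Suc n)
    have "to_fract c * to_fract (z n) = to_fract a * to_fract (z (Suc n))"
      using z_Suc[of n] by (metis to_fract_mult)
    then show ?case
      using a Suc by (simp add: x_def field_simps)
  qed (simp add: z_def)
  obtain n where n: "z n \<in> ideal_span (z ` {..<n})"
  proof -
    let ?C = "range (\<lambda>n. ideal_span (z ` {..<n}))"
    have "\<Union>?C \<in> ?C"
    proof (rule ideal_chain_Union)
      show "I \<subseteq> J \<or> J \<subseteq> I" if IJ: "I \<in> ?C" "J \<in> ?C" for I J
      proof -
        have "ideal_span (z ` {..<m}) \<subseteq> ideal_span (z ` {..<n})" if "m \<le> n" for m n
          by (rule ring_mod.span_mono) (use that in auto)
        moreover obtain m n where "I = ideal_span (z ` {..<m})" "J = ideal_span (z ` {..<n})"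
          using IJ by blast
        ultimately show ?thesis
          using nat_le_linear by blast
      qed
    qed auto
    then obtain n where n: "\<Union>?C = ideal_span (z ` {..<n})"
      by blast
    have "z n \<in> ideal_span (z ` {..<Suc n})"
      by (rule ring_mod.span_base) auto
    then show ?thesis
      using n that by blast
  qed
  have "\<exists>d. v = (\<Sum>i<n. d i * z i)" if "v \<in> ideal_span (z ` {..<n})" for v
    using that
  proof (induction rule: ring_mod.span_induct_alt)
    case base
    show ?case by (rule exI[of _ "\<lambda>_. 0"]) simp
  next
    case (step k w v)
    then obtain d j where "v = (\<Sum>i<n. d i * z i)" "j < n" "w = z j"
      by auto
    then have "k * w + v = (\<Sum>i<n. (d i + (if i = j then k else 0)) * z i)"
      by (simp add: distrib_right sum.distrib if_distrib[of "\<lambda>t. t * _"] cong: if_cong)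
    then show ?case by (rule exI[of _ "\<lambda>i. d i + (if i = j then k else 0)"])
  qed
  then obtain d where "z n = (\<Sum>i<n. d i * z i)"
    using n by blast
  then have "to_fract (z n) = (\<Sum>i<n. to_fract (d i) * to_fract (z i))"
    by simp
  then have "x ^ n * to_fract y = (\<Sum>i<n. to_fract (d i) * x ^ i) * to_fract y"
    by (simp add: z_x sum_distrib_right mult.assoc)
  then have x_pow: "x ^ n = (\<Sum>i<n. to_fract (d i) * x ^ i)"
    using y by simp
  define p where "p = monom 1 n - (\<Sum>i<n. monom (d i) i)"
  have coeff_p: "coeff p k = (if k = n then 1 else if k < n then - d k else 0)" for k
    by (simp add: p_def coeff_sum)
  have "degree p \<le> n"
    by (rule degree_le) (simp add: coeff_p)
  moreover have "n \<le> degree p"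
    by (rule le_degree) (simp add: coeff_p)
  ultimately have "lead_coeff p = 1"
    by (simp add: coeff_p)
  moreover have "map_poly to_fract p = monom 1 n - (\<Sum>i<n. monom (to_fract (d i)) i)"
    by (rule poly_eqI) (simp add: coeff_map_poly coeff_p coeff_sum)
  then have "poly (map_poly to_fract p) x = 0"
    by (simp add: poly_sum poly_monom x_pow)
  ultimately have "integral_over_base x"
    unfolding integral_over_base_def by blast
  then obtain b where "x = to_fract b"
    using dedekind by (auto simp: dedekind_domain_def integrally_closed_domain_def)
  then have "to_fract c = to_fract (a * b)"
    using a by (simp add: x_def field_simps)
  then show ?thesis
    by (metis dvd_triv_left to_fract_eq_iff)
qed

section \<open>Inverses of non-zero primes and the splitting off of prime factors\<close>

lemma is_ideal_scale: "is_ideal I \<Longrightarrow> is_ideal ((*) a ` I)"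
proof (rule ring_mod.subspaceI)
  assume I: "is_ideal I"
  show "0 \<in> (*) a ` I"
    using ring_mod.subspace_0[OF I] by (intro image_eqI[of _ _ 0]) simp_all
  show "x + y \<in> (*) a ` I" if "x \<in> (*) a ` I" "y \<in> (*) a ` I" for x y
    using that ring_mod.subspace_add[OF I] by (auto simp: distrib_left[symmetric])
  show "c * x \<in> (*) a ` I" if "x \<in> (*) a ` I" for c x
    using that ring_mod.subspace_scale[OF I, of _ c] by (auto simp: mult.left_commute[of c])
qed

lemma principal_times_subset:
  assumes "is_ideal I"
  shows "{x. a dvd x} \<star> I \<subseteq> (*) a ` I"
proof (rule times_subsetI[OF is_ideal_scale[OF assms]])
  fix x y assume "x \<in> {x. a dvd x}" "y \<in> I"
  then obtain c where "x = a * c" by (auto elim: dvdE)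
  then show "x * y \<in> (*) a ` I"
    using ring_mod.subspace_scale[OF assms \<open>y \<in> I\<close>, of c] by (auto simp: mult.assoc)
qed

text \<open>\<open>P\<close> is an associated prime of the quotient by \<open>a\<close>. Among the
  annihilators of classes \<open>b\<close> that lie inside \<open>P\<close>, a maximal one is prime;
  it contains \<open>a\<close>, so it is non-zero, and dimension one makes it equal to
  \<open>P\<close>.\<close>

lemma prime_eq_colon:
  assumes P: "is_prime (P :: 'a set)" "P \<noteq> {0}"
  obtains a b where "a \<noteq> 0" "a \<in> P" "\<not> a dvd b" "P = {x. a dvd b * x}"
proof -
  have idP: "is_ideal P"
    using P by (simp add: is_prime_def)
  then obtain a where a: "a \<in> P" "a \<noteq> 0"
    using P ring_mod.subspace_0 by blast
  let ?K = "\<lambda>b. {x. a dvd b * x}"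
  let ?S = "{K. \<exists>b. K = ?K b \<and> K \<subseteq> P}"
  have K: "is_ideal (?K b)" for b
    using is_ideal_quotient[OF is_ideal_principal[of a], of b] by simp
  have "a * c \<in> P" for c
    using ring_mod.subspace_scale[OF idP a(1), of c] by (simp add: mult.commute)
  then have "?K 1 \<in> ?S"
    by (auto elim!: dvdE intro!: exI[of _ 1])
  then obtain M where M: "M \<in> ?S" and max: "\<And>I. I \<in> ?S \<Longrightarrow> M \<subseteq> I \<Longrightarrow> I = M"
    using maximal_ideal_exists[of ?S] K by blast
  then obtain b where b: "M = ?K b" "M \<subseteq> P"
    by blast
  have max': "?K c = M" if "?K c \<subseteq> P" "M \<subseteq> ?K c" for c
    using max that by blast
  have "is_prime M"
    unfolding is_prime_def
  proof (intro conjI allI impI)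
    show "is_ideal M" using K b by simp
    show "1 \<notin> M" using b(2) P by (auto simp: is_prime_def)
    fix x y assume xy: "x * y \<in> M"
    \<comment> \<open>If the annihilator of \<open>b * x\<close> stays inside \<open>P\<close>,
      maximality makes it \<open>M\<close>, and it contains \<open>y\<close>. Otherwise some
      \<open>s\<close> outside \<open>P\<close> kills \<open>b * x\<close>; passing from
      \<open>b\<close> to \<open>b * s\<close> keeps the annihilator inside \<open>P\<close>, so
      that it is again \<open>M\<close>, and it contains \<open>x\<close>.\<close>
    show "x \<in> M \<or> y \<in> M"
    proof (cases "?K (b * x) \<subseteq> P")
      case True
      moreover have "M \<subseteq> ?K (b * x)"
        using b by (auto simp: mult.assoc mult.left_commute[of b x] intro: dvd_mult)
      ultimately have "?K (b * x) = M"
        by (rule max')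
      then show ?thesis
        using xy b by (auto simp: mult.assoc)
    next
      case False
      then obtain s where s: "a dvd b * x * s" "s \<notin> P"
        by blast
      have "z \<in> P" if "a dvd b * s * z" for z
      proof -
        have "s * z \<in> M" using that b by (simp add: mult.assoc)
        then show ?thesis
          using b(2) s(2) P(1) unfolding is_prime_def by blast
      qed
      then have "?K (b * s) \<subseteq> P"
        by blast
      moreover have "M \<subseteq> ?K (b * s)"
        using b by (auto simp: mult.assoc mult.left_commute[of b s] intro: dvd_mult)
      ultimately have "?K (b * s) = M"
        by (rule max')
      moreover have "x \<in> ?K (b * s)"
        using s(1) by (simp add: mult.assoc mult.commute mult.left_commute)
      ultimately show ?thesis
        by blast
    qed
  qed
  moreover have "M \<noteq> {0}"
    using a b by auto
  ultimately have "P = M"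
    using nonzero_prime_maximal P(1) b(2) by blast
  moreover have "\<not> a dvd b"
    using P b calculation unfolding is_prime_def by auto
  ultimately show ?thesis
    using that a b by blast
qed

text \<open>\<open>Q\<close> is the inverse fractional ideal of \<open>P\<close> multiplied by
  \<open>a\<close>, which keeps it inside the ring. With \<open>a\<close> and \<open>b\<close> from
  \<open>prime_eq_colon\<close>, the fraction \<open>b / a\<close> lies in that inverse but not in
  the ring. If \<open>P\<close> times its inverse were proper, it would equal \<open>P\<close>; then
  \<open>b / a\<close> would map \<open>P\<close> into itself and be integral, against integral
  closedness.\<close>

lemma prime_inverse:
  assumes P: "is_prime (P :: 'a set)" "P \<noteq> {0}"
  obtains Q a where "is_ideal Q" "a \<noteq> 0" "P \<star> Q = {x. a dvd x}"
proof -
  have idP: "is_ideal P"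
    using P by (simp add: is_prime_def)
  obtain a b where a: "a \<noteq> 0" "a \<in> P" and b: "\<not> a dvd b" and P_eq: "P = {x. a dvd b * x}"
    using prime_eq_colon[OF P] by blast
  define Q where "Q = {c. \<forall>x\<in>P. c * x \<in> {x. a dvd x}}"
  have Q: "is_ideal Q"
    unfolding Q_def by (rule is_ideal_colon[OF is_ideal_principal])
  have PQ: "P \<star> Q \<subseteq> {x. a dvd x}"
    by (rule times_subsetI[OF is_ideal_principal]) (auto simp: Q_def mult.commute)
  \<comment> \<open>This is \<open>P\<close> times its inverse, rescaled by
    \<open>a\<close>.\<close>
  define I where "I = {y. a * y \<in> P \<star> Q}"
  have I: "is_ideal I"
    unfolding I_def by (rule is_ideal_quotient[OF is_ideal_times[OF idP Q]])
  have "a \<in> Q"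
    by (simp add: Q_def)
  then have "P \<subseteq> I"
    unfolding I_def using times_mem[of _ P a Q] by (auto simp: mult.commute)
  have "b \<in> Q"
    using P_eq by (auto simp: Q_def)
  have "1 \<in> I"
  proof (rule ccontr)
    assume "1 \<notin> I"
    then obtain M where M: "is_prime M" "I \<subseteq> M"
      using prime_over_ideal[OF I] by blast
    then have "I = P"
      using nonzero_prime_maximal[OF P M(1)] \<open>P \<subseteq> I\<close> by blast
    have "a dvd b"
    proof (rule dvd_if_scale_subset[OF idP P(2) a(1)])
      fix x assume "x \<in> P"
      then obtain y where y: "b * x = a * y"
        using P_eq by (auto elim: dvdE)
      then have "a * y \<in> P \<star> Q"
        using times_mem[OF \<open>x \<in> P\<close> \<open>b \<in> Q\<close>] by (simp add: mult.commute)
      then show "\<exists>y\<in>P. b * x = a * y"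
        using y \<open>I = P\<close> I_def by blast
    qed
    then show False using b by simp
  qed
  then have "a \<in> P \<star> Q"
    by (simp add: I_def)
  then have "x * a \<in> P \<star> Q" for x
    using ring_mod.subspace_scale[OF is_ideal_times[OF idP Q]] by blast
  then have "{x. a dvd x} \<subseteq> P \<star> Q"
    by (auto elim!: dvdE simp: mult.commute)
  then show ?thesis
    using that[OF Q a(1)] PQ by blast
qed

lemma prime_times_cancel:
  assumes P: "is_prime (P :: 'a set)" "P \<noteq> {0}" and I: "is_ideal I" and J: "is_ideal J"
    and sub: "P \<star> I \<subseteq> P \<star> J"
  shows "I \<subseteq> J"
proof
  fix x assume "x \<in> I"
  have idP: "is_ideal P"
    using P by (simp add: is_prime_def)
  obtain Q a where Q: "is_ideal Q" and a: "a \<noteq> 0" and PQ: "P \<star> Q = {x. a dvd x}"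
    using prime_inverse[OF P] by blast
  have "a * x \<in> (P \<star> Q) \<star> I"
    using PQ \<open>x \<in> I\<close> by (intro times_mem) auto
  also have "\<dots> = Q \<star> (P \<star> I)"
    using times_commute[OF idP Q] times_assoc[OF Q idP I] by simp
  also have "\<dots> \<subseteq> Q \<star> (P \<star> J)"
    by (intro times_mono is_ideal_times Q idP J sub subset_refl)
  also have "\<dots> = (P \<star> Q) \<star> J"
    using times_commute[OF idP Q] times_assoc[OF Q idP J] by simp
  also have "\<dots> \<subseteq> (*) a ` J"
    using principal_times_subset[OF J] PQ by simp
  finally show "x \<in> J"
    using a by auto
qed

text \<open>\<open>J\<close> is the inverse of \<open>P\<close> times \<open>I\<close>. It is
  strictly larger than \<open>I\<close>, because otherwise every element of the inverse would map
  \<open>I\<close> into itself, hence be integral and lie in the ring, which would put 1 into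
  \<open>P\<close>. The strictness drives the inductions on ideals that follow.\<close>

lemma prime_factor:
  assumes P: "is_prime (P :: 'a set)" "P \<noteq> {0}" and I: "is_ideal I" "I \<noteq> {0}" "I \<subseteq> P"
  obtains J where "is_ideal J" "I = P \<star> J" "I \<subset> J"
proof -
  have idP: "is_ideal P"
    using P by (simp add: is_prime_def)
  obtain Q a where Q: "is_ideal Q" and a: "a \<noteq> 0" and PQ: "P \<star> Q = {x. a dvd x}"
    using prime_inverse[OF P] by blast
  have QP: "Q \<star> P = {x. a dvd x}"
    using PQ times_commute[OF idP Q] by simp
  define J where "J = {y. a * y \<in> Q \<star> I}"
  have J: "is_ideal J"
    unfolding J_def by (rule is_ideal_quotient[OF is_ideal_times[OF Q I(1)]])
  have QI: "Q \<star> I \<subseteq> (*) a ` J"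
  proof
    fix w assume "w \<in> Q \<star> I"
    moreover have "Q \<star> I \<subseteq> {x. a dvd x}"
      using times_mono[OF Q idP subset_refl I(3)] QP by simp
    ultimately show "w \<in> (*) a ` J"
      by (auto simp: J_def elim!: dvdE)
  qed
  have "I = P \<star> J"
  proof
    show "P \<star> J \<subseteq> I"
    proof (rule times_subsetI[OF I(1)])
      fix p y assume p: "p \<in> P" and y: "y \<in> J"
      have "p * (a * y) \<in> P \<star> (Q \<star> I)"
        using times_mem[OF p, of "a * y"] y by (simp add: J_def)
      also have "\<dots> = {x. a dvd x} \<star> I"
        using times_assoc[OF idP Q I(1)] PQ by simp
      also have "\<dots> \<subseteq> (*) a ` I"
        by (rule principal_times_subset[OF I(1)])
      finally obtain i where "p * (a * y) = a * i" "i \<in> I"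
        by auto
      then have "a * (p * y) = a * i"
        by (simp add: mult.left_commute)
      then show "p * y \<in> I"
        using a \<open>i \<in> I\<close> by simp
    qed
    show "I \<subseteq> P \<star> J"
    proof
      fix i assume "i \<in> I"
      then have "a * i \<in> (P \<star> Q) \<star> I"
        using PQ by (intro times_mem) auto
      also have "\<dots> = P \<star> (Q \<star> I)"
        using times_assoc[OF idP Q I(1)] .
      also have "\<dots> \<subseteq> (*) a ` (P \<star> J)"
      proof (rule times_subsetI[OF is_ideal_scale[OF is_ideal_times[OF idP J]]])
        fix p w assume "p \<in> P" "w \<in> Q \<star> I"
        then obtain y where y: "w = a * y" "y \<in> J"
          using QI by blast
        then have "p * w = a * (p * y)"
          by (simp add: mult.left_commute)
        then show "p * w \<in> (*) a ` (P \<star> J)"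
          using times_mem[OF \<open>p \<in> P\<close> y(2)] by blast
      qed
      finally show "i \<in> P \<star> J"
        using a by auto
    qed
  qed
  moreover have "I \<noteq> J"
  proof
    assume "I = J"
    have "a dvd c" if c: "c \<in> Q" for c
    proof (rule dvd_if_scale_subset[OF I(1,2) a])
      fix x assume "x \<in> I"
      then have "c * x \<in> Q \<star> I"
        using c by (intro times_mem)
      then show "\<exists>y\<in>I. c * x = a * y"
        using QI \<open>I = J\<close> by blast
    qed
    then have "P \<star> Q \<subseteq> P \<star> {x. a dvd x}"
      by (intro times_mono idP is_ideal_principal) auto
    also have "\<dots> = {x. a dvd x} \<star> P"
      by (rule times_commute[OF idP is_ideal_principal])
    also have "\<dots> \<subseteq> (*) a ` P"
      by (rule principal_times_subset[OF idP])
    finally have "a \<in> (*) a ` P"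
      using PQ by auto
    then have "1 \<in> P"
      using a by auto
    then show False
      using P by (simp add: is_prime_def)
  qed
  moreover have "P \<star> J \<subseteq> J"
    using times_subset_left[OF J, of P] times_commute[OF J idP] by simp
  ultimately show ?thesis
    using that[OF J] by blast
qed

text \<open>A prime over \<open>P \<star> J\<close> contains \<open>P\<close>, and then equals it,
  or contains the larger ideal \<open>J\<close>.\<close>

lemma finite_primes_over:
  assumes "is_ideal (I :: 'a set)" "I \<noteq> {0}"
  shows "finite {P. is_prime P \<and> I \<subseteq> P}"
  using assms
proof (induction I rule: noetherian_induct)
  case (step I)
  show ?case
  proof (cases "1 \<in> I")
    case True
    then have "{P. is_prime P \<and> I \<subseteq> P} = {}"
      by (auto simp: is_prime_def)
    then show ?thesis
      by (simp only: finite.emptyI)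
  next
    case False
    then obtain P where P: "is_prime P" "I \<subseteq> P"
      using prime_over_ideal step.hyps by blast
    have "P \<noteq> {0}"
      using P(2) step ring_mod.subspace_0 by blast
    obtain J where J: "is_ideal J" "I = P \<star> J" "I \<subset> J"
      using prime_factor[OF P(1) \<open>P \<noteq> {0}\<close> step.hyps _ P(2)] step.prems by blast
    have "J \<noteq> {0}"
      using J(3) ring_mod.subspace_0[OF step.hyps] by blast
    then have "finite {P. is_prime P \<and> J \<subseteq> P}"
      using step.IH J by blast
    moreover have "{P. is_prime P \<and> I \<subseteq> P} \<subseteq> insert P {P. is_prime P \<and> J \<subseteq> P}"
      using is_prime_times_subset[of _ P J] nonzero_prime_maximal[OF P(1) \<open>P \<noteq> {0}\<close>] J(2) by blast
    ultimately show ?thesis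
      by (meson finite_insert finite_subset)
  qed
qed

section \<open>Simultaneous congruences\<close>

lemma one_mod_prime:
  assumes P: "is_prime (P :: 'a set)" "P \<noteq> {0}" and J: "is_ideal J" "\<not> J \<subseteq> P"
  obtains z where "z \<in> J" "z - 1 \<in> P"
proof -
  obtain j where j: "j \<in> J" "j \<notin> P"
    using J by blast
  obtain v where v: "j * v - 1 \<in> P"
    by (rule unit_mod_ideal[of P j]) (use P j nonzero_prime_maximal[OF P] in \<open>auto simp: is_prime_def\<close>)
  have "j * v \<in> J"
    using ring_mod.subspace_scale[OF J(1) j(1), of v] by (simp add: mult.commute)
  then show ?thesis
    using v that by blast
qed

lemma one_mod_prime_zero_mod_others:
  assumes P: "is_prime (P :: 'a set)" "P \<noteq> {0}" and "finite F"
    and "\<And>Q. Q \<in> F \<Longrightarrow> is_prime Q \<and> Q \<noteq> {0} \<and> Q \<noteq> P"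
  obtains s where "s - 1 \<in> P" "\<And>Q. Q \<in> F \<Longrightarrow> s \<in> Q"
proof -
  have idP: "is_ideal P"
    using P by (simp add: is_prime_def)
  have "\<exists>s. s - 1 \<in> P \<and> (\<forall>Q\<in>F. s \<in> Q)"
    using assms(3,4)
  proof (induction F)
    case empty
    then show ?case
      using ring_mod.subspace_0[OF idP] by (intro exI[of _ 1]) simp
  next
    case (insert Q F)
    then obtain s where s: "s - 1 \<in> P" "\<forall>Q\<in>F. s \<in> Q"
      by auto
    have Q: "is_prime Q" "Q \<noteq> {0}" "Q \<noteq> P"
      using insert.prems by auto
    have idQ: "is_ideal Q"
      using Q by (simp add: is_prime_def)
    have "\<not> Q \<subseteq> P"
      using nonzero_prime_maximal[OF Q(1,2) P(1)] Q(3) by blast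
    then obtain z where z: "z \<in> Q" "z - 1 \<in> P"
      using one_mod_prime[OF P idQ] by blast
    have "s * z - 1 = s * (z - 1) + (s - 1)"
      by (simp add: algebra_simps)
    then have "s * z - 1 \<in> P"
      using ring_mod.subspace_add[OF idP] ring_mod.subspace_scale[OF idP] s z by metis
    moreover have "s * z \<in> Q"
      using ring_mod.subspace_scale[OF idQ z(1)] by blast
    moreover have "s * z \<in> Q'" if "Q' \<in> F" for Q'
    proof -
      have "is_ideal Q'"
        using insert.prems that by (auto simp: is_prime_def)
      then show ?thesis
        using ring_mod.subspace_scale[of Q' s z] s(2) that by (simp add: mult.commute)
    qed
    ultimately show ?case
      by (intro exI[of _ "s * z"]) auto
  qed
  then show ?thesis
    using that by blast
qed

text \<open>The corrections can be taken inside \<open>I\<close> because no prime in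
  \<open>F\<close> contains \<open>I\<close>. The semilocal argument needs such a solution inside
  the level; the splitting into two summands uses \<open>I = UNIV\<close>.\<close>

lemma chinese_remainder_in_ideal:
  assumes I: "is_ideal (I :: 'a set)" and "finite F"
    and "\<And>P. P \<in> F \<Longrightarrow> is_prime P \<and> P \<noteq> {0} \<and> \<not> I \<subseteq> P"
  obtains y where "y \<in> I" "\<And>P. P \<in> F \<Longrightarrow> y - f P \<in> P"
proof -
  have "\<exists>y\<in>I. \<forall>P\<in>F. y - f P \<in> P"
    using assms(2,3)
  proof (induction F)
    case empty
    then show ?case
      using ring_mod.subspace_0[OF I] by blast
  next
    case (insert P F)
    then obtain y where y: "y \<in> I" "\<forall>P\<in>F. y - f P \<in> P"
      by auto
    have P: "is_prime P" "P \<noteq> {0}" "\<not> I \<subseteq> P"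
      using insert.prems by auto
    have idP: "is_ideal P"
      using P by (simp add: is_prime_def)
    have F: "is_prime Q \<and> Q \<noteq> {0} \<and> Q \<noteq> P" if "Q \<in> F" for Q
      using insert.prems insert.hyps that by auto
    obtain s where s: "s - 1 \<in> P" "\<And>Q. Q \<in> F \<Longrightarrow> s \<in> Q"
      using one_mod_prime_zero_mod_others[OF P(1,2) insert.hyps(1) F] by blast
    obtain z where z: "z \<in> I" "z - 1 \<in> P"
      using one_mod_prime[OF P(1,2) I P(3)] by blast
    \<comment> \<open>The factor \<open>s\<close> is 1 at \<open>P\<close> and 0 at the earlier
      primes, while \<open>z\<close> is 1 at \<open>P\<close> and keeps the correction in
      \<open>I\<close>.\<close>
    define w where "w = y + (f P - y) * s * z"
    have "w \<in> I"
      unfolding w_def by (intro ring_mod.subspace_add[OF I] ring_mod.subspace_scale[OF I] y z)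
    moreover have "w - f P = (f P - y) * s * (z - 1) + (f P - y) * (s - 1)"
      by (simp add: w_def algebra_simps)
    then have "w - f P \<in> P"
      using ring_mod.subspace_add[OF idP] ring_mod.subspace_scale[OF idP] s(1) z(2) by metis
    moreover have "w - f Q \<in> Q" if "Q \<in> F" for Q
    proof -
      have Q: "is_ideal Q"
        using F[OF that] by (simp add: is_prime_def)
      have "w - f Q = (y - f Q) + ((f P - y) * z) * s"
        by (simp add: w_def algebra_simps)
      then show ?thesis
        using ring_mod.subspace_add[OF Q] ring_mod.subspace_scale[OF Q] s(2) y(2) that by metis
    qed
    ultimately show ?case
      by auto
  qed
  then show ?thesis
    using that by blast
qed

section \<open>Orders of ideals at primes\<close>

abbreviation ideals_monoid :: "'a set ring"
  where "ideals_monoid \<equiv> ideals_set \<D>"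

abbreviation ideal_pow :: "'a set \<Rightarrow> nat \<Rightarrow> 'a set"
  where "ideal_pow I n \<equiv> I [^]\<^bsub>ideals_monoid\<^esub> n"

abbreviation prime_power_prod :: "('a set \<Rightarrow> nat) \<Rightarrow> 'a set set \<Rightarrow> 'a set"
  where "prime_power_prod e A \<equiv> finprod ideals_monoid (\<lambda>P. ideal_pow P (e P)) A"

sublocale ideals: comm_monoid ideals_monoid
  by (rule type_ring.ideals_set_is_comm_monoid)

lemma ideals_set_simps:
  "I \<in> carrier ideals_monoid \<longleftrightarrow> is_ideal I"
  "monoid.mult ideals_monoid = (\<star>)"
  "monoid.one ideals_monoid = UNIV"
  by (auto simp: ideals_set_def ideal_iff)

lemma is_ideal_pow: "is_ideal I \<Longrightarrow> is_ideal (ideal_pow I n)"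
  using ideals.nat_pow_closed[of I n] by (simp add: ideals_set_simps)

lemma ideal_pow_Suc: "ideal_pow I (Suc n) = ideal_pow I n \<star> I"
  by (simp add: ideals_set_simps)

lemma ideal_pow_antimono: "is_ideal I \<Longrightarrow> m \<le> n \<Longrightarrow> ideal_pow I n \<subseteq> ideal_pow I m"
  by (rule lift_Suc_antimono_le[of "ideal_pow I"]) (metis ideal_pow_Suc times_subset_left is_ideal_pow)

lemma is_ideal_prime_power_prod:
  assumes "\<And>Q. Q \<in> A \<Longrightarrow> is_ideal Q"
  shows "is_ideal (prime_power_prod e A)"
  using ideals.finprod_closed[of "\<lambda>P. ideal_pow P (e P)" A] assms is_ideal_pow
  by (auto simp: ideals_set_simps)

lemma prime_power_prod_insert:
  assumes "finite A" "Q \<notin> A" "is_ideal Q" "\<And>P. P \<in> A \<Longrightarrow> is_ideal P"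
  shows "prime_power_prod e (insert Q A) = ideal_pow Q (e Q) \<star> prime_power_prod e A"
proof -
  have "(\<lambda>P. ideal_pow P (e P)) \<in> A \<rightarrow> carrier ideals_monoid" "ideal_pow Q (e Q) \<in> carrier ideals_monoid"
    using assms is_ideal_pow by (auto simp: ideals_set_simps)
  then show ?thesis
    using ideals.finprod_insert[OF assms(1,2)] by (simp add: ideals_set_simps)
qed

lemma prime_power_prod_not_subset:
  assumes P: "is_prime P" and "finite A" and A: "\<And>Q. Q \<in> A \<Longrightarrow> is_prime Q \<and> Q \<noteq> {0} \<and> Q \<noteq> P"
  shows "\<not> prime_power_prod e A \<subseteq> P"
  using assms(2,3)
proof (induction A)
  case empty
  then show ?case
    using P by (auto simp: ideals_set_simps is_prime_def)
next
  case (insert Q A)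
  have Q: "is_prime Q" "Q \<noteq> {0}" "Q \<noteq> P"
    using insert.prems by auto
  have "\<not> Q \<subseteq> P"
    using nonzero_prime_maximal[OF Q(1,2) P] Q(3) by blast
  have "\<not> ideal_pow Q n \<subseteq> P" for n
  proof (induction n)
    case 0
    then show ?case
      using P by (auto simp: is_prime_def ideals_set_simps)
  next
    case (Suc n)
    then show ?case
      using is_prime_times_subset[OF P, of "ideal_pow Q n" Q] \<open>\<not> Q \<subseteq> P\<close>
      unfolding ideal_pow_Suc by blast
  qed
  moreover have "\<not> prime_power_prod e A \<subseteq> P"
    using insert by blast
  moreover have "prime_power_prod e (insert Q A) = ideal_pow Q (e Q) \<star> prime_power_prod e A"
    using insert.prems by (intro prime_power_prod_insert insert.hyps) (auto simp: is_prime_def)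
  ultimately show ?case
    using is_prime_times_subset[OF P] by metis
qed

lemma prime_power_times_cancel:
  assumes P: "is_prime P" "P \<noteq> {0}" and I: "is_ideal I" and J: "is_ideal J"
    and sub: "ideal_pow P n \<star> I \<subseteq> ideal_pow P n \<star> J"
  shows "I \<subseteq> J"
  using I J sub
proof (induction n arbitrary: I J)
  case 0
  then show ?case
    by (simp add: ideals_set_simps UNIV_times)
next
  case (Suc n)
  have idP: "is_ideal P"
    using P by (simp add: is_prime_def)
  have "ideal_pow P n \<star> (P \<star> I) \<subseteq> ideal_pow P n \<star> (P \<star> J)"
    using Suc.prems unfolding ideal_pow_Suc by (simp only: times_assoc is_ideal_pow idP)
  then have "P \<star> I \<subseteq> P \<star> J"
    using Suc.IH is_ideal_times idP Suc.prems by blast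
  then show ?case
    using prime_times_cancel[OF P] Suc.prems by blast
qed

text \<open>This is the predicate under the definite description in \<open>ord_ideal\<close>, with
  \<open>is_prime\<close> for \<open>primeideal\<close>; its existence and uniqueness allow that
  description to be evaluated.\<close>

definition is_prime_factorization :: "('a set \<Rightarrow> nat) \<Rightarrow> 'a set \<Rightarrow> bool"
  where "is_prime_factorization e I \<longleftrightarrow>
    finite {P. e P \<noteq> 0} \<and> (\<forall>P. e P \<noteq> 0 \<longrightarrow> is_prime P \<and> P \<noteq> {0}) \<and>
    I = prime_power_prod e {P. e P \<noteq> 0}"

lemma prime_factorization_extract:
  assumes "finite {P. e P \<noteq> 0}" "\<And>P. e P \<noteq> 0 \<Longrightarrow> is_prime P \<and> P \<noteq> {0}" "is_ideal P"
  shows "prime_power_prod e {Q. e Q \<noteq> 0} = ideal_pow P (e P) \<star> prime_power_prod e ({Q. e Q \<noteq> 0} - {P})"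
proof (cases "e P = 0")
  case True
  then have "{Q. e Q \<noteq> 0} - {P} = {Q. e Q \<noteq> 0}"
    by auto
  moreover have id: "is_ideal (prime_power_prod e {Q. e Q \<noteq> 0})"
    using assms(2) by (intro is_ideal_prime_power_prod) (auto simp: is_prime_def)
  ultimately show ?thesis
    using True by (simp add: ideals_set_simps UNIV_times)
next
  case False
  then have "{Q. e Q \<noteq> 0} = insert P ({Q. e Q \<noteq> 0} - {P})"
    by auto
  moreover have "prime_power_prod e (insert P ({Q. e Q \<noteq> 0} - {P}))
      = ideal_pow P (e P) \<star> prime_power_prod e ({Q. e Q \<noteq> 0} - {P})"
    using assms by (intro prime_power_prod_insert) (auto simp: is_prime_def)
  ultimately show ?thesis
    by metis
qed

lemma prime_factorization_exists:
  assumes "is_ideal (I :: 'a set)" "I \<noteq> {0}"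
  shows "\<exists>e. is_prime_factorization e I"
  using assms
proof (induction I rule: noetherian_induct)
  case (step I)
  show ?case
  proof (cases "1 \<in> I")
    case True
    then have "is_prime_factorization (\<lambda>_. 0) I"
      using one_mem_ideal[OF step.hyps] by (simp add: is_prime_factorization_def ideals_set_simps)
    then show ?thesis
      by blast
  next
    case False
    then obtain P where P: "is_prime P" "I \<subseteq> P"
      using prime_over_ideal step.hyps by blast
    have idP: "is_ideal P"
      using P by (simp add: is_prime_def)
    have "P \<noteq> {0}"
      using P(2) step ring_mod.subspace_0 by blast
    obtain J where J: "is_ideal J" "I = P \<star> J" "I \<subset> J"
      using prime_factor[OF P(1) \<open>P \<noteq> {0}\<close> step.hyps _ P(2)] step.prems by blast
    have "J \<noteq> {0}"
      using J(3) ring_mod.subspace_0[OF step.hyps] by blast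
    then obtain e where e: "is_prime_factorization e J"
      using step.IH J by blast
    define e' where "e' = e(P := Suc (e P))"
    have supp: "{Q. e' Q \<noteq> 0} = insert P {Q. e Q \<noteq> 0}"
      by (auto simp: e'_def)
    have fin: "finite {Q. e Q \<noteq> 0}" "finite {Q. e' Q \<noteq> 0}"
      using e unfolding is_prime_factorization_def supp by blast+
    have primes: "\<And>Q. e Q \<noteq> 0 \<Longrightarrow> is_prime Q \<and> Q \<noteq> {0}" "\<And>Q. e' Q \<noteq> 0 \<Longrightarrow> is_prime Q \<and> Q \<noteq> {0}"
      using e P \<open>P \<noteq> {0}\<close> by (auto simp: is_prime_factorization_def e'_def split: if_splits)
    let ?R = "prime_power_prod e ({Q. e Q \<noteq> 0} - {P})"
    have R: "is_ideal ?R"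
      using primes by (intro is_ideal_prime_power_prod) (auto simp: is_prime_def)
    have "prime_power_prod e' ({Q. e' Q \<noteq> 0} - {P}) = ?R"
    proof (rule ideals.finprod_cong')
      show "{Q. e' Q \<noteq> 0} - {P} = {Q. e Q \<noteq> 0} - {P}"
        by (auto simp: e'_def)
      show "(\<lambda>Q. ideal_pow Q (e Q)) \<in> {Q. e Q \<noteq> 0} - {P} \<rightarrow> carrier ideals_monoid"
        using primes is_ideal_pow by (auto simp: ideals_set_simps is_prime_def)
      show "ideal_pow Q (e' Q) = ideal_pow Q (e Q)" if "Q \<in> {Q. e Q \<noteq> 0} - {P}" for Q
        using that by (auto simp: e'_def)
    qed
    then have "prime_power_prod e' {Q. e' Q \<noteq> 0} = (ideal_pow P (e P) \<star> P) \<star> ?R"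
      using prime_factorization_extract[OF fin(2) primes(2) idP] ideal_pow_Suc[of P "e P"]
      by (simp add: e'_def)
    also have "\<dots> = P \<star> (ideal_pow P (e P) \<star> ?R)"
      by (simp only: times_commute[of _ P] times_assoc is_ideal_pow idP R)
    also have "\<dots> = I"
      using prime_factorization_extract[OF fin(1) primes(1) idP] e J(2)
      by (simp add: is_prime_factorization_def)
    finally have "is_prime_factorization e' I"
      using fin primes by (simp add: is_prime_factorization_def)
    then show ?thesis
      by blast
  qed
qed

text \<open>Cancelling \<open>ideal_pow P (e P)\<close> from an inclusion in the next power would
  put the product over the other primes into \<open>P\<close>. The exponent thus depends on
  \<open>I\<close> alone, which yields both uniqueness and a test for order one.\<close>

lemma subset_prime_power_iff:
  assumes e: "is_prime_factorization e I" and P: "is_prime P" "P \<noteq> {0}"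
  shows "I \<subseteq> ideal_pow P n \<longleftrightarrow> n \<le> e P"
proof -
  have idP: "is_ideal P"
    using P by (simp add: is_prime_def)
  have fin: "finite {P. e P \<noteq> 0}" and primes: "\<And>P. e P \<noteq> 0 \<Longrightarrow> is_prime P \<and> P \<noteq> {0}"
    using e by (auto simp: is_prime_factorization_def)
  let ?R = "prime_power_prod e ({Q. e Q \<noteq> 0} - {P})"
  have R: "is_ideal ?R"
    using primes by (intro is_ideal_prime_power_prod) (auto simp: is_prime_def)
  have I: "I = ideal_pow P (e P) \<star> ?R"
    using prime_factorization_extract[OF fin primes idP] e by (simp add: is_prime_factorization_def)
  show ?thesis
  proof
    assume sub: "I \<subseteq> ideal_pow P n"
    show "n \<le> e P"
    proof (rule ccontr)
      assume "\<not> n \<le> e P"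
      then have "ideal_pow P (e P) \<star> ?R \<subseteq> ideal_pow P (e P) \<star> P"
        using sub ideal_pow_antimono[OF idP, of "Suc (e P)" n] I ideal_pow_Suc[of P "e P"] by auto
      then have "?R \<subseteq> P"
        by (rule prime_power_times_cancel[OF P R idP])
      moreover have "\<not> ?R \<subseteq> P"
        by (rule prime_power_prod_not_subset[OF P(1)]) (use fin primes in auto)
      ultimately show False
        by blast
    qed
  next
    assume "n \<le> e P"
    then show "I \<subseteq> ideal_pow P n"
      using ideal_pow_antimono[OF idP] times_subset_left[OF is_ideal_pow[OF idP]] I by blast
  qed
qed

lemma prime_factorization_unique:
  assumes "is_prime_factorization e I" "is_prime_factorization e' I"
  shows "e = e'"
proof
  fix P
  show "e P = e' P"
  proof (cases "is_prime P \<and> P \<noteq> {0}")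
    case True
    then show ?thesis
      using subset_prime_power_iff[OF assms(1), of P] subset_prime_power_iff[OF assms(2), of P]
      by (metis order_antisym order_refl)
  next
    case False
    then show ?thesis
      using assms unfolding is_prime_factorization_def by metis
  qed
qed

lemma ord_ideal_eq_1:
  assumes I: "is_ideal (I :: 'a set)" "I \<noteq> {0}" and P: "is_prime P" "I \<subseteq> P" "\<not> I \<subseteq> P \<star> P"
  shows "ord_ideal P I = 1"
proof -
  obtain e where e: "is_prime_factorization e I"
    using prime_factorization_exists[OF I] by blast
  have "ord_ideal P I = (THE e. is_prime_factorization e I) P"
    by (simp add: ord_ideal_def is_prime_factorization_def primeideal_iff)
  also have "(THE e. is_prime_factorization e I) = e"
    using e prime_factorization_unique by blast
  also have "e P = 1"
  proof -
    have "P \<noteq> {0}"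
      using I P(2) ring_mod.subspace_0 by blast
    have idP: "is_ideal P"
      using P by (simp add: is_prime_def)
    have "ideal_pow P 1 = P"
      using ideals.nat_pow_eone[of P] idP by (simp add: ideals_set_simps)
    moreover from this have "ideal_pow P 2 = P \<star> P"
      using ideal_pow_Suc[of P 1] by (simp add: numeral_2_eq_2)
    ultimately have "1 \<le> e P" "\<not> 2 \<le> e P"
      using subset_prime_power_iff[OF e P(1) \<open>P \<noteq> {0}\<close>] P by metis+
    then show ?thesis
      by simp
  qed
  finally show ?thesis .
qed

end

text \<open>The three cosets are those of 0, 1 and -1; the last two differ because 2 is not in
  \<open>P\<close>.\<close>

lemma card_Quot_eq_3:
  assumes P: "is_prime (P :: 'a::idom set)" "2 \<notin> P" and P3: "\<And>x. x \<in> P \<or> x - 1 \<in> P \<or> x + 1 \<in> P"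
  shows "card (carrier (\<D> Quot P)) = 3"
proof -
  have idP: "is_ideal P"
    using P by (simp add: is_prime_def)
  define c where "c x = {h + x | h. h \<in> P}" for x
  have mem_c: "y \<in> c x \<longleftrightarrow> y - x \<in> P" for x y
  proof
    assume "y - x \<in> P"
    then have "(y - x) + x \<in> c x"
      unfolding c_def by blast
    then show "y \<in> c x" by simp
  qed (auto simp: c_def)
  have c_eq: "c x = c y \<longleftrightarrow> x - y \<in> P" for x y
  proof
    assume "c x = c y"
    then show "x - y \<in> P"
      using mem_c[of x x] mem_c[of x y] ring_mod.subspace_0[OF idP] by simp
  next
    assume xy: "x - y \<in> P"
    show "c x = c y"
    proof (rule Set.set_eqI)
      fix z
      have "z - x \<in> P \<longleftrightarrow> z - y \<in> P"
        using ring_mod.subspace_add[OF idP _ xy, of "z - x"] ring_mod.subspace_diff[OF idP _ xy, of "z - y"] by auto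
      then show "z \<in> c x \<longleftrightarrow> z \<in> c y"
        by (simp add: mem_c)
    qed
  qed
  have "c x \<in> {c 0, c 1, c (- 1)}" for x
    using P3[of x] by (simp add: c_eq)
  moreover have "carrier (\<D> Quot P) = range c"
    by (auto simp: FactRing_def A_RCOSETS_def' a_r_coset_def' c_def)
  ultimately have "carrier (\<D> Quot P) = {c 0, c 1, c (- 1)}"
    by auto
  moreover have "c 0 \<noteq> c 1" "c 1 \<noteq> c (- 1)" "c 0 \<noteq> c (- 1)"
    using P ring_mod.subspace_neg[OF idP, of "- 1"] by (auto simp: c_eq is_prime_def)
  ultimately show ?thesis
    by simp
qed

section \<open>Normal subgroups of SL2 given by matrix entries\<close>

text \<open>These rules take explicit coefficients through \<open>of\<close>, so that ideal
  membership of a matrix entry reduces to a polynomial identity.\<close>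

lemma ideal_lin1:
  assumes "is_ideal I" "x \<in> I" "z = p * x"
  shows "z \<in> I"
  using assms ring_mod.subspace_scale by blast

lemma ideal_lin2:
  assumes "is_ideal I" "x \<in> I" "y \<in> I" "z = p * x + q * y"
  shows "z \<in> I"
  using assms by (simp add: ring_mod.subspace_add ring_mod.subspace_scale)

lemma ideal_lin4:
  assumes "is_ideal I" "x \<in> I" "y \<in> I" "x' \<in> I" "y' \<in> I" "z = p * x + q * y + p' * x' + q' * y'"
  shows "z \<in> I"
  using assms by (simp add: ring_mod.subspace_add ring_mod.subspace_scale)

lemma ideal_cong_mem:
  assumes "is_ideal I" "x - y \<in> I"
  shows "x \<in> I \<longleftrightarrow> y \<in> I"
  using ring_mod.subspace_add[OF assms, of y] ring_mod.subspace_diff[OF assms(1) _ assms(2), of x] by auto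

text \<open>The subgroup is represented by the predicate \<open>N a b c d\<close> on the matrix with rows (a, b) and
  (c, d); only invariance under conjugation by elementary matrices is required.\<close>

locale elementary_normal =
  fixes N :: "'a::idom \<Rightarrow> 'a \<Rightarrow> 'a \<Rightarrow> 'a \<Rightarrow> bool"
  assumes det: "N a b c d \<Longrightarrow> a * d - b * c = 1"
    and one: "N 1 0 0 1"
    and mult: "N a b c d \<Longrightarrow> N a' b' c' d' \<Longrightarrow>
      N (a * a' + b * c') (a * b' + b * d') (c * a' + d * c') (c * b' + d * d')"
    and inv: "N a b c d \<Longrightarrow> N d (- b) (- c) a"
    and conj_upper: "N a b c d \<Longrightarrow> N (a + t * c) (b + t * d - t * a - t\<^sup>2 * c) c (d - t * c)"
    and conj_lower: "N a b c d \<Longrightarrow> N (a - t * b) b (c + t * a - t * d - t\<^sup>2 * b) (d + t * b)"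
begin

definition contains_principal :: "'a set \<Rightarrow> bool"
  where "contains_principal I \<longleftrightarrow>
    (\<forall>a b c d. a * d - b * c = 1 \<longrightarrow> a - 1 \<in> I \<longrightarrow> b \<in> I \<longrightarrow> c \<in> I \<longrightarrow> d - 1 \<in> I \<longrightarrow> N a b c d)"

text \<open>If X and X' are the two matrices, then X' times the inverse of X is congruent to the
  identity modulo \<open>I\<close>; multiplying it by X gives X'.\<close>

lemma cong_closed:
  assumes I: "is_ideal I" "contains_principal I" and N: "N a b c d" and det': "a' * d' - b' * c' = 1"
    and c1: "a' - a \<in> I" and c2: "b' - b \<in> I" and c3: "c' - c \<in> I" and c4: "d' - d \<in> I"
  shows "N a' b' c' d'"
proof -
  note dt = det[OF N]
  have "N (a' * d - b' * c) (b' * a - a' * b) (c' * d - d' * c) (d' * a - c' * b)"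
  proof (rule I(2)[unfolded contains_principal_def, rule_format])
    show "(a' * d - b' * c) * (d' * a - c' * b) - (b' * a - a' * b) * (c' * d - d' * c) = 1"
    proof -
      have "(a' * d - b' * c) * (d' * a - c' * b) - (b' * a - a' * b) * (c' * d - d' * c)
          = (a * d - b * c) * (a' * d' - b' * c')"
        by (simp add: algebra_simps)
      then show ?thesis
        using dt det' by simp
    qed
    show "a' * d - b' * c - 1 \<in> I"
      by (rule ideal_lin2[OF I(1) c1 c2, of _ d "- c"]) (simp add: dt[symmetric] algebra_simps)
    show "b' * a - a' * b \<in> I"
      by (rule ideal_lin2[OF I(1) c2 c1, of _ a "- b"]) (simp add: algebra_simps)
    show "c' * d - d' * c \<in> I"
      by (rule ideal_lin2[OF I(1) c3 c4, of _ d "- c"]) (simp add: algebra_simps)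
    show "d' * a - c' * b - 1 \<in> I"
      by (rule ideal_lin2[OF I(1) c4 c3, of _ a "- b"]) (simp add: dt[symmetric] algebra_simps)
  qed
  from mult[OF this N]
  have "N (a' * (a * d - b * c)) (b' * (a * d - b * c)) (c' * (a * d - b * c)) (d' * (a * d - b * c))"
    by (simp add: algebra_simps)
  then show ?thesis
    by (simp only: dt mult_1_right)
qed

lemma upper_add: "N 1 r 0 1 \<Longrightarrow> N 1 s 0 1 \<Longrightarrow> N 1 (r + s) 0 1"
  using mult[of 1 r 0 1 1 s 0 1] by (simp add: add.commute)

lemma upper_neg: "N 1 r 0 1 \<Longrightarrow> N 1 (- r) 0 1"
  using inv[of 1 r 0 1] by simp

lemma upper_diff: "N 1 r 0 1 \<Longrightarrow> N 1 s 0 1 \<Longrightarrow> N 1 (r - s) 0 1"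
  using upper_add[of r "- s"] upper_neg[of s] by simp

text \<open>The two conjugations multiply to the Weyl element with rows (0, 1) and (-1, 0) times an
  upper unipotent, and the latter commutes with the given matrix.\<close>

lemma upper_imp_lower:
  assumes "N 1 r 0 1"
  shows "N 1 0 r 1"
proof -
  have "N (1 + r) r (- r) (1 - r)"
    using conj_lower[OF assms, of "- 1"] by simp
  from conj_upper[OF this, of 1] have "N 1 0 (- r) 1"
    by (simp add: algebra_simps)
  from inv[OF this] show ?thesis
    by simp
qed

lemma lower_imp_upper:
  assumes "N 1 0 s 1"
  shows "N 1 s 0 1"
proof -
  have "N (1 + s) (- s) s (1 - s)"
    using conj_upper[OF assms, of 1] by simp
  from conj_lower[OF this, of "- 1"] have "N 1 (- s) 0 1"
    by (simp add: algebra_simps)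
  from inv[OF this] show ?thesis
    by simp
qed

text \<open>Modulo I, conjugation by the product of the elementary matrices with entries u, -v, u
  (upper, lower, upper) is conjugation by the monomial matrix with rows (0, u) and (-v, 0).\<close>

lemma upper_unit_square:
  assumes I: "is_ideal I" "contains_principal I" and r: "N 1 r 0 1" and uv: "u * v - 1 \<in> I"
  shows "N 1 (v\<^sup>2 * r) 0 1"
proof -
  \<comment> \<open>Two conjugations suffice: the factor of the product that acts first is upper
    unipotent and fixes this matrix.\<close>
  have "N (1 + v * r) r (- (v\<^sup>2 * r)) (1 - v * r)"
    using conj_lower[OF r, of "- v"] by simp
  note N = conj_upper[OF this, of u]
  have "N 1 0 (- (v\<^sup>2 * r)) 1"
  proof (rule cong_closed[OF I N])
    show "1 * 1 - 0 * - (v\<^sup>2 * r) = 1"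
      by simp
    show "1 - (1 + v * r + u * - (v\<^sup>2 * r)) \<in> I"
      by (rule ideal_lin1[OF I(1) uv, of _ "v * r"]) (simp add: algebra_simps power2_eq_square)
    show "0 - (r + u * (1 - v * r) - u * (1 + v * r) - u\<^sup>2 * - (v\<^sup>2 * r)) \<in> I"
      by (rule ideal_lin1[OF I(1) uv, of _ "- r * (u * v - 1)"]) (simp add: algebra_simps power2_eq_square)
    show "- (v\<^sup>2 * r) - - (v\<^sup>2 * r) \<in> I"
      using ring_mod.subspace_0[OF I(1)] by simp
    show "1 - (1 - v * r - u * - (v\<^sup>2 * r)) \<in> I"
      by (rule ideal_lin1[OF I(1) uv, of _ "- v * r"]) (simp add: algebra_simps power2_eq_square)
  qed
  from inv[OF this] have "N 1 0 (v\<^sup>2 * r) 1"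
    by simp
  then show ?thesis
    by (rule lower_imp_upper)
qed

text \<open>Modulo I, the matrix is a lower unipotent times the conjugate of the lower unipotent with
  entry t = a - 1 by the upper unipotent with entry 1 times an upper unipotent.\<close>

lemma principal_unit_corner:
  assumes I: "is_ideal I" "contains_principal I" and Q: "is_ideal Q" "\<And>t. t \<in> Q \<Longrightarrow> N 1 t 0 1"
    and dt: "a * d - b * c = 1" and a: "a - 1 \<in> Q" and b: "b \<in> Q" and c: "c \<in> Q" and as: "a * s - 1 \<in> I"
  shows "N a b c d"
proof -
  define t where "t = a - 1"
  \<comment> \<open>With \<open>s\<close> inverse to \<open>a\<close> modulo \<open>I\<close>, the
    entries \<open>e\<close> and \<open>f\<close> solve \<open>e * a + t = c\<close> and
    \<open>a * f - t = b\<close> modulo \<open>I\<close>.\<close>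
  define e where "e = s * (c - t)"
  define f where "f = s * (b + t)"
  have t: "t \<in> Q"
    using a by (simp add: t_def)
  have "e \<in> Q" "f \<in> Q"
    unfolding e_def f_def
    by (intro ring_mod.subspace_scale[OF Q(1)] ring_mod.subspace_diff[OF Q(1)] ring_mod.subspace_add[OF Q(1)] t b c)+
  then have e: "N 1 0 e 1" and f: "N 1 f 0 1"
    using Q(2) upper_imp_lower by blast+
  have "N a (- t) t (1 - t)"
    using conj_upper[OF upper_imp_lower[OF Q(2)[OF t]], of 1] by (simp add: t_def)
  from mult[OF e this] have "N a (- t) (e * a + t) (e * - t + (1 - t))"
    by simp
  from mult[OF this f] have N: "N a (a * f - t) (e * a + t) ((e * a + t) * f + (e * - t + (1 - t)))"
    by simp
  show ?thesis
  proof (rule cong_closed[OF I N dt])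
    show "a - a \<in> I"
      using ring_mod.subspace_0[OF I(1)] by simp
    show b': "b - (a * f - t) \<in> I"
      by (rule ideal_lin1[OF I(1) as, of _ "- (b + t)"]) (simp add: f_def algebra_simps)
    show c': "c - (e * a + t) \<in> I"
      by (rule ideal_lin1[OF I(1) as, of _ "- (c - t)"]) (simp add: e_def algebra_simps)
    \<comment> \<open>The fourth entry is controlled by the determinant: three entries agree modulo
      \<open>I\<close>, so \<open>a * m\<close> is in \<open>I\<close>, and \<open>a\<close> is a
      unit there.\<close>
    define m where "m = d - ((e * a + t) * f + (e * - t + (1 - t)))"
    have "a * m = (a * d - b * c) - 1 + (c * (b - (a * f - t)) + (a * f - t) * (c - (e * a + t)))"
      by (simp add: m_def t_def algebra_simps)
    then have am: "a * m \<in> I"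
      using dt by (intro ideal_lin2[OF I(1) b' c', of _ c "a * f - t"]) simp
    have "m \<in> I"
      by (rule ideal_lin2[OF I(1) as am, of _ "- m" s]) (simp add: algebra_simps)
    then show "d - ((e * a + t) * f + (e * - t + (1 - t))) \<in> I"
      by (simp only: m_def)
  qed
qed

end

section \<open>The level ideal and its principal congruence subgroup\<close>

locale dedekind_elementary_normal = dedekind type_of_ring + elementary_normal N
  for type_of_ring :: "'a::idom itself" and N :: "'a \<Rightarrow> 'a \<Rightarrow> 'a \<Rightarrow> 'a \<Rightarrow> bool"
begin

text \<open>Only finitely many primes lie over \<open>I\<close>, so a multiple of \<open>b\<close>
  can be added to \<open>a\<close> to make the corner a unit modulo \<open>I\<close>. Taking the
  multiplier \<open>t\<close> in \<open>Q\<close> keeps the matrix congruent to the identity modulo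
  \<open>Q\<close> and lets the change be undone by a lower unipotent already in the
  subgroup.\<close>

lemma contains_principal_if_upper:
  assumes I: "is_ideal I" "I \<noteq> {0}" "contains_principal I"
    and Q: "is_ideal Q" "\<And>t. t \<in> Q \<Longrightarrow> N 1 t 0 1"
  shows "contains_principal Q"
  unfolding contains_principal_def
proof (intro allI impI)
  fix a b c d
  assume dt: "a * d - b * c = 1" and a: "a - 1 \<in> Q" and b: "b \<in> Q" and c: "c \<in> Q"
  let ?F = "{P. is_prime P \<and> I \<subseteq> P}"
  let ?F' = "{P \<in> ?F. \<not> Q \<subseteq> P}"
  have "finite ?F'"
    by (rule finite_subset[OF _ finite_primes_over[OF I(1,2)]]) blast
  moreover have "is_prime P \<and> P \<noteq> {0} \<and> \<not> Q \<subseteq> P" if "P \<in> ?F'" for P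
    using that I ring_mod.subspace_0[OF I(1)] by blast
  \<comment> \<open>At a prime containing \<open>Q\<close> the new corner is 1 for any
    \<open>t\<close> in \<open>Q\<close>. At the other primes over \<open>I\<close> it is
    \<open>a\<close> if \<open>a\<close> is a unit there, and otherwise \<open>a + b\<close> up to
    the prime, which is non-zero by the determinant.\<close>
  ultimately obtain t where t: "t \<in> Q" and tP: "\<And>P. P \<in> ?F' \<Longrightarrow> t - (if a \<in> P then 1 else 0) \<in> P"
    using chinese_remainder_in_ideal[OF Q(1), of ?F' "\<lambda>P. if a \<in> P then 1 else 0"] by blast
  have "a + t * b \<notin> P" if P: "is_prime P" "I \<subseteq> P" for P
  proof
    assume atb: "a + t * b \<in> P"
    have idP: "is_ideal P" and "1 \<notin> P"
      using P by (auto simp: is_prime_def)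
    have "1 \<in> P"
    proof (cases "Q \<subseteq> P")
      case True
      show ?thesis
        by (rule ideal_lin4[OF idP atb, of "t * b" "a - 1" "a - 1" _ 1 "-1" "-1" 0])
          (use True a b t ring_mod.subspace_scale[OF Q(1)] in auto)
    next
      case False
      then have tP': "t - (if a \<in> P then 1 else 0) \<in> P"
        using tP P by simp
      show ?thesis
      proof (cases "a \<in> P")
        case True
        then have "t - 1 \<in> P"
          using tP' by simp
        show ?thesis
          by (rule ideal_lin4[OF idP True True \<open>t - 1 \<in> P\<close> atb, of _ d c "b * c" "- c"]) (use dt in \<open>simp add: algebra_simps\<close>)
      next
        case False
        then have "t \<in> P"
          using tP' by simp
        then have "a \<in> P"
          by (intro ideal_lin2[OF idP atb \<open>t \<in> P\<close>, of a 1 "- b"]) (simp add: algebra_simps)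
        with False show ?thesis
          by blast
      qed
    qed
    with \<open>1 \<notin> P\<close> show False
      by blast
  qed
  then obtain s where s: "(a + t * b) * s - 1 \<in> I"
    using unit_mod_ideal[OF I(1)] by blast
  have "N (a + t * b) b (c + t * d) d"
  proof (rule principal_unit_corner[OF I(1,3) Q _ _ b _ s])
    show "(a + t * b) * d - b * (c + t * d) = 1"
      using dt by (simp add: algebra_simps)
    show "a + t * b - 1 \<in> Q"
      by (rule ideal_lin2[OF Q(1) a b, of _ 1 t]) (simp add: algebra_simps)
    show "c + t * d \<in> Q"
      by (rule ideal_lin2[OF Q(1) c t, of _ 1 d]) (simp add: algebra_simps)
  qed
  moreover have "N 1 0 (- t) 1"
    using Q(2)[OF t] upper_imp_lower upper_neg by blast
  ultimately show "N a b c d"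
    using mult[of "a + t * b" b "c + t * d" d 1 0 "- t" 1] by (simp add: mult.commute)
qed

text \<open>The largest ideal inside the quasi-level in terms of \<open>N\<close>: an element
  belongs to it when its whole principal ideal lies in the quasi-level.\<close>

definition level_ideal :: "'a set"
  where "level_ideal = {r. \<forall>d. N 1 (r * d) 0 1}"

lemma is_ideal_level_ideal: "is_ideal level_ideal"
proof (rule ring_mod.subspaceI)
  show "0 \<in> level_ideal"
    using one by (simp add: level_ideal_def)
  show "x + y \<in> level_ideal" if "x \<in> level_ideal" "y \<in> level_ideal" for x y
    using that upper_add by (simp add: level_ideal_def distrib_right)
  show "c * x \<in> level_ideal" if "x \<in> level_ideal" for c x
  proof -
    have "N 1 (c * x * d) 0 1" for d
    proof -
      have "N 1 (x * (c * d)) 0 1"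
        using that by (simp add: level_ideal_def)
      then show ?thesis
        by (simp add: mult_ac)
    qed
    then show ?thesis
      by (simp add: level_ideal_def)
  qed
qed

lemma level_ideal_upper: "t \<in> level_ideal \<Longrightarrow> N 1 t 0 1"
  using level_ideal_def by (metis (no_types, lifting) mem_Collect_eq mult_1_right)

end

section \<open>Residue fields with three elements\<close>

text \<open>For odd P this says that the residue field has three elements.\<close>

definition norm_three :: "'a::comm_ring_1 set \<Rightarrow> bool"
  where "norm_three P \<longleftrightarrow> (\<forall>x. x \<in> P \<or> x - 1 \<in> P \<or> x + 1 \<in> P)"

text \<open>If \<open>x\<close> is not 1 or -1 modulo \<open>P\<close>, take \<open>y = 0\<close>.
  If \<open>x\<close> is \<open>e\<close> with \<open>e\<close> one of 1 and -1, take
  \<open>a\<close> different from 0, 1 and -1. Then \<open>y = a\<close> fails only when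
  \<open>a\<close> is \<open>2 * e\<close>, and \<open>y = - a\<close> only when \<open>a\<close> is
  \<open>- 2 * e\<close>; both cannot happen since 4 is not in \<open>P\<close>.\<close>

lemma split_off_pm_one:
  assumes P: "is_prime P" "2 \<notin> P" and x: "norm_three P \<Longrightarrow> x \<in> P"
  shows "\<exists>y. y - 1 \<notin> P \<and> y + 1 \<notin> P \<and> x - y - 1 \<notin> P \<and> x - y + 1 \<notin> P"
proof -
  have idP: "is_ideal P" and one: "1 \<notin> P"
    using P by (auto simp: is_prime_def)
  have neg: "- z \<in> P \<longleftrightarrow> z \<in> P" for z
    using ring_mod.subspace_neg[OF idP, of z] ring_mod.subspace_neg[OF idP, of "- z"] by auto
  have four: "4 \<notin> P"
  proof
    assume "4 \<in> P"
    then have "2 * 2 \<in> P" by simp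
    then show False using P unfolding is_prime_def by blast
  qed
  show ?thesis
  proof (cases "x - 1 \<notin> P \<and> x + 1 \<notin> P")
    case True
    then show ?thesis
      using one neg[of 1] by (intro exI[of _ 0]) simp
  next
    case False
    have "\<not> norm_three P"
    proof
      assume "norm_three P"
      then have "x \<in> P" by (rule x)
      then have "1 \<in> P"
        using False ring_mod.subspace_diff[OF idP, of x "x - 1"] ring_mod.subspace_diff[OF idP, of "x + 1" x] by auto
      then show False using one by blast
    qed
    then obtain a where a: "a \<notin> P" "a - 1 \<notin> P" "a + 1 \<notin> P"
      by (auto simp: norm_three_def)
    have "- a - 1 = - (a + 1)" "- a + 1 = - (a - 1)"
      by simp_all
    then have a': "- a - 1 \<notin> P" "- a + 1 \<notin> P"
      using a neg by metis+
    have "a - 2 \<notin> P \<or> a + 2 \<notin> P"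
    proof (rule ccontr)
      assume "\<not> ?thesis"
      then have "(a + 2) - (a - 2) \<in> P"
        using ring_mod.subspace_diff[OF idP] by blast
      then show False using four by simp
    qed
    have key: "x - y - 1 \<notin> P \<and> x - y + 1 \<notin> P"
      if "x - e \<in> P" "e - y - 1 \<notin> P" "e - y + 1 \<notin> P" for y e
      using that ideal_cong_mem[OF idP, of "x - y - 1" "e - y - 1"] ideal_cong_mem[OF idP, of "x - y + 1" "e - y + 1"]
      by simp
    have eqs: "1 - - a - 1 = a" "1 - - a + 1 = a + 2" "1 - a - 1 = - a" "1 - a + 1 = - (a - 2)"
      "- 1 - - a - 1 = a - 2" "- 1 - - a + 1 = a" "- 1 - a - 1 = - (a + 2)" "- 1 - a + 1 = - a"
      by simp_all
    consider "x - 1 \<in> P" | "x - (- 1) \<in> P"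
      using False by auto
    then show ?thesis
    proof cases
      case 1
      show ?thesis
      proof (cases "a - 2 \<in> P")
        case True
        then have "a + 2 \<notin> P"
          using \<open>a - 2 \<notin> P \<or> a + 2 \<notin> P\<close> by blast
        then show ?thesis
          using key[OF 1, of "- a", unfolded eqs] a a' by blast
      next
        case False
        then show ?thesis
          using key[OF 1, of a, unfolded eqs neg] a by blast
      qed
    next
      case 2
      show ?thesis
      proof (cases "a + 2 \<in> P")
        case True
        then have "a - 2 \<notin> P"
          using \<open>a - 2 \<notin> P \<or> a + 2 \<notin> P\<close> by blast
        then show ?thesis
          using key[OF 2, of "- a", unfolded eqs] a a' by blast
      next
        case False
        then show ?thesis
          using key[OF 2, of a, unfolded eqs neg] a by blast
      qed
    qed
  qed
qed

section \<open>Scaling upper unipotents by units and by the radical at primes of norm three\<close>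

context dedekind_elementary_normal
begin

lemma upper_unit_square_level:
  assumes Q: "contains_principal level_ideal" and r: "N 1 r 0 1"
    and x: "\<And>P. is_prime P \<Longrightarrow> level_ideal \<subseteq> P \<Longrightarrow> x \<notin> P"
  shows "N 1 (x\<^sup>2 * r) 0 1"
proof -
  obtain u where "x * u - 1 \<in> level_ideal"
    using unit_mod_ideal[OF is_ideal_level_ideal x] by blast
  then have "u * x - 1 \<in> level_ideal"
    by (simp add: mult.commute)
  then show ?thesis
    by (rule upper_unit_square[OF is_ideal_level_ideal Q r])
qed

text \<open>4 x = (x + 1)^2 - (x - 1)^2, and 4 is a square of a unit.\<close>

lemma upper_scale_if_pm_one_units:
  assumes Q: "contains_principal level_ideal" and r: "N 1 r 0 1"
    and two: "\<And>P. is_prime P \<Longrightarrow> level_ideal \<subseteq> P \<Longrightarrow> 2 \<notin> P"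
    and x: "\<And>P. is_prime P \<Longrightarrow> level_ideal \<subseteq> P \<Longrightarrow> x - 1 \<notin> P \<and> x + 1 \<notin> P"
  shows "N 1 (x * r) 0 1"
proof -
  have "N 1 ((x + 1)\<^sup>2 * r - (x - 1)\<^sup>2 * r) 0 1"
    using x by (intro upper_diff upper_unit_square_level[OF Q r]) auto
  moreover obtain w where w: "2 * w - 1 \<in> level_ideal"
    using unit_mod_ideal[OF is_ideal_level_ideal two] by blast
  ultimately have "N 1 (w\<^sup>2 * ((x + 1)\<^sup>2 * r - (x - 1)\<^sup>2 * r)) 0 1"
    using upper_unit_square[OF is_ideal_level_ideal Q] by blast
  moreover have "x * r - w\<^sup>2 * ((x + 1)\<^sup>2 * r - (x - 1)\<^sup>2 * r) \<in> level_ideal"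
    by (rule ideal_lin1[OF is_ideal_level_ideal w, of _ "- x * r * (2 * w + 1)"])
      (simp add: algebra_simps power2_eq_square)
  ultimately show ?thesis
    using upper_add level_ideal_upper diff_add_cancel by metis
qed

text \<open>This is J of the overview. When no prime over the level has norm three it is the whole
  ring, and \<open>three_radical_times_upper\<close> with \<open>x = 1\<close> already puts
  \<open>r\<close> in the level.\<close>

definition three_radical :: "'a set"
  where "three_radical = {x. \<forall>P. is_prime P \<longrightarrow> level_ideal \<subseteq> P \<longrightarrow> norm_three P \<longrightarrow> x \<in> P}"

lemma three_radical_scale: "x \<in> three_radical \<Longrightarrow> c * x \<in> three_radical"
  by (auto simp: three_radical_def is_prime_def ring_mod.subspace_scale)

text \<open>The local splittings of \<open>x\<close> at the finitely many primes over the level are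
  glued by the Chinese remainder theorem to one splitting \<open>y + (x - y)\<close>.\<close>

lemma upper_scale_three_radical:
  assumes Q: "level_ideal \<noteq> {0}" "contains_principal level_ideal" and r: "N 1 r 0 1"
    and two: "\<And>P. is_prime P \<Longrightarrow> level_ideal \<subseteq> P \<Longrightarrow> 2 \<notin> P"
    and x: "x \<in> three_radical"
  shows "N 1 (x * r) 0 1"
proof -
  let ?F = "{P. is_prime P \<and> level_ideal \<subseteq> P}"
  have "\<forall>P\<in>?F. \<exists>y. y - 1 \<notin> P \<and> y + 1 \<notin> P \<and> x - y - 1 \<notin> P \<and> x - y + 1 \<notin> P"
    using split_off_pm_one two x unfolding three_radical_def by blast
  then obtain f where f: "\<And>P. P \<in> ?F \<Longrightarrow> f P - 1 \<notin> P \<and> f P + 1 \<notin> P \<and> x - f P - 1 \<notin> P \<and> x - f P + 1 \<notin> P"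
    by metis
  have "is_prime P \<and> P \<noteq> {0} \<and> \<not> UNIV \<subseteq> P" if "P \<in> ?F" for P
    using that Q(1) ring_mod.subspace_0[OF is_ideal_level_ideal] by (auto simp: is_prime_def)
  then obtain y where y: "\<And>P. P \<in> ?F \<Longrightarrow> y - f P \<in> P"
    using chinese_remainder_in_ideal[OF ring_mod.subspace_UNIV finite_primes_over[OF is_ideal_level_ideal Q(1)], of f]
    by blast
  have good: "y - 1 \<notin> P \<and> y + 1 \<notin> P \<and> x - y - 1 \<notin> P \<and> x - y + 1 \<notin> P"
    if "is_prime P" "level_ideal \<subseteq> P" for P
  proof -
    have idP: "is_ideal P"
      using that by (simp add: is_prime_def)
    have d: "y - f P \<in> P"
      using y that by simp
    then have d': "f P - y \<in> P"
      using ring_mod.subspace_neg[OF idP d] by simp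
    show ?thesis
      using f[of P] that d d'
        ideal_cong_mem[OF idP, of "y - 1" "f P - 1"] ideal_cong_mem[OF idP, of "y + 1" "f P + 1"]
        ideal_cong_mem[OF idP, of "x - y - 1" "x - f P - 1"] ideal_cong_mem[OF idP, of "x - y + 1" "x - f P + 1"]
      by simp
  qed
  have "N 1 (y * r) 0 1" "N 1 ((x - y) * r) 0 1"
    using good by (auto intro!: upper_scale_if_pm_one_units[OF Q(2) r two])
  from upper_add[OF this] show ?thesis
    by (simp add: algebra_simps)
qed

lemma three_radical_times_upper:
  assumes "level_ideal \<noteq> {0}" "contains_principal level_ideal" "N 1 r 0 1"
    and "\<And>P. is_prime P \<Longrightarrow> level_ideal \<subseteq> P \<Longrightarrow> 2 \<notin> P"
    and x: "x \<in> three_radical"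
  shows "x * r \<in> level_ideal"
proof -
  have "N 1 (x * r * d) 0 1" for d
    using upper_scale_three_radical[OF assms(1-4) three_radical_scale[OF x, of d]] by (simp add: mult_ac)
  then show ?thesis
    by (simp add: level_ideal_def)
qed

text \<open>If \<open>r\<close> is a unit at \<open>P\<close>, every \<open>p\<close> in
  \<open>P\<close> is made into an element of \<open>three_radical\<close> by a factor
  \<open>s\<close> that is 1 at \<open>P\<close>. Then \<open>p * s * r\<close> lies in the level,
  hence in \<open>P \<star> P\<close>, and inverting \<open>s * r\<close> modulo \<open>P\<close>
  puts \<open>p\<close> itself there. Cancelling \<open>P\<close> from
  \<open>P \<subseteq> P \<star> P\<close> is absurd.\<close>

lemma upper_in_three_radical:
  assumes Q: "level_ideal \<noteq> {0}" "contains_principal level_ideal" and r: "N 1 r 0 1"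
    and two: "\<And>P. is_prime P \<Longrightarrow> level_ideal \<subseteq> P \<Longrightarrow> 2 \<notin> P"
    and sq: "\<And>P. is_prime P \<Longrightarrow> level_ideal \<subseteq> P \<Longrightarrow> norm_three P \<Longrightarrow> level_ideal \<subseteq> P \<star> P"
  shows "r \<in> three_radical"
  unfolding three_radical_def
proof (intro CollectI allI impI)
  fix P assume P: "is_prime P" "level_ideal \<subseteq> P" "norm_three P"
  have idP: "is_ideal P" and "1 \<notin> P"
    using P by (auto simp: is_prime_def)
  have nz: "P' \<noteq> {0}" if "level_ideal \<subseteq> P'" for P'
    using that Q(1) ring_mod.subspace_0[OF is_ideal_level_ideal] by blast
  show "r \<in> P"
  proof (rule ccontr)
    assume "r \<notin> P"
    let ?F = "{P'. is_prime P' \<and> level_ideal \<subseteq> P'} - {P}"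
    have "finite ?F"
      using finite_primes_over[OF is_ideal_level_ideal Q(1)] by blast
    then obtain s where s: "s - 1 \<in> P" "\<And>P'. P' \<in> ?F \<Longrightarrow> s \<in> P'"
      using one_mod_prime_zero_mod_others[OF P(1) nz[OF P(2)], of ?F] nz by blast
    have "s \<notin> P"
      using ideal_cong_mem[OF idP s(1)] \<open>1 \<notin> P\<close> by simp
    then have "s * r \<notin> P"
      using \<open>r \<notin> P\<close> P(1) unfolding is_prime_def by blast
    then obtain v where v: "(s * r) * v - 1 \<in> P"
      using unit_mod_ideal[OF idP] nonzero_prime_maximal[OF P(1) nz[OF P(2)]] by metis
    have "p \<in> P \<star> P" if p: "p \<in> P" for p
    proof -
      \<comment> \<open>At \<open>P\<close> the factor \<open>p\<close> gives membership, at the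
        other primes over the level the factor \<open>s\<close>.\<close>
      have "p * s \<in> three_radical"
        unfolding three_radical_def
      proof (intro CollectI allI impI)
        fix P' assume P': "is_prime P'" "level_ideal \<subseteq> P'" "norm_three P'"
        then have idP': "is_ideal P'"
          by (simp add: is_prime_def)
        show "p * s \<in> P'"
        proof (cases "P' = P")
          case True
          then show ?thesis
            using ring_mod.subspace_scale[OF idP p, of s] by (simp add: mult.commute)
        next
          case False
          then show ?thesis
            using ring_mod.subspace_scale[OF idP' s(2), of p] P' by blast
        qed
      qed
      then have "p * s * r \<in> P \<star> P"
        using three_radical_times_upper[OF Q r two] sq[OF P] by blast
      moreover have "p * ((s * r) * v - 1) \<in> P \<star> P"
        using p v by (rule times_mem)
      ultimately show ?thesis
        by (rule ideal_lin2[OF is_ideal_times[OF idP idP], of _ _ _ v "- 1"]) (simp add: algebra_simps)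
    qed
    then have "P \<star> UNIV \<subseteq> P \<star> P"
      using times_UNIV[OF idP] by auto
    then have "UNIV \<subseteq> P"
      by (rule prime_times_cancel[OF P(1) nz[OF P(2)] ring_mod.subspace_UNIV idP])
    then show False
      using \<open>1 \<notin> P\<close> by blast
  qed
qed

section \<open>First-order calculus modulo the level\<close>

text \<open>The subgroup contains the identity plus r times the traceless matrix with rows (x, y) and
  (z, -x), up to the level ideal. When r^2 lies in the level ideal this is an additive condition.\<close>

definition tangent :: "'a \<Rightarrow> 'a \<Rightarrow> 'a \<Rightarrow> 'a \<Rightarrow> bool"
  where "tangent r x y z \<longleftrightarrow> (\<exists>a b c d. N a b c d \<and> a - (1 + r * x) \<in> level_ideal \<and>
    b - r * y \<in> level_ideal \<and> c - r * z \<in> level_ideal \<and> d - (1 - r * x) \<in> level_ideal)"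

lemma tangentE:
  assumes "tangent r x y z"
  obtains a b c d where "N (1 + r * x + a) (r * y + b) (r * z + c) (1 - r * x + d)"
    "a \<in> level_ideal" "b \<in> level_ideal" "c \<in> level_ideal" "d \<in> level_ideal"
proof -
  obtain a b c d where "N a b c d" and m: "a - (1 + r * x) \<in> level_ideal"
    "b - r * y \<in> level_ideal" "c - r * z \<in> level_ideal" "d - (1 - r * x) \<in> level_ideal"
    using assms by (auto simp: tangent_def)
  then have "N (1 + r * x + (a - (1 + r * x))) (r * y + (b - r * y)) (r * z + (c - r * z))
      (1 - r * x + (d - (1 - r * x)))"
    by simp
  then show ?thesis
    using m by (rule that)
qed

lemma tangentI:
  assumes "N a b c d" "a - (1 + r * x) \<in> level_ideal" "b - r * y \<in> level_ideal"
    "c - r * z \<in> level_ideal" "d - (1 - r * x) \<in> level_ideal"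
  shows "tangent r x y z"
  using assms unfolding tangent_def by blast

text \<open>The inverse of 1 + rB is 1 - rB modulo the level, as B is traceless, and the product (1
  + rA)(1 - rB) differs from 1 + r(A - B) by a multiple of the square of r.\<close>

lemma tangent_diff:
  assumes rr: "r * r \<in> level_ideal" and "tangent r x y z" "tangent r x' y' z'"
  shows "tangent r (x - x') (y - y') (z - z')"
proof -
  note I = is_ideal_level_ideal
  obtain a b c d where N: "N (1 + r * x + a) (r * y + b) (r * z + c) (1 - r * x + d)"
    and m: "a \<in> level_ideal" "b \<in> level_ideal" "c \<in> level_ideal" "d \<in> level_ideal"
    using assms(2) by (rule tangentE)
  obtain a' b' c' d' where N': "N (1 + r * x' + a') (r * y' + b') (r * z' + c') (1 - r * x' + d')"
    and m': "a' \<in> level_ideal" "b' \<in> level_ideal" "c' \<in> level_ideal" "d' \<in> level_ideal"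
    using assms(3) by (rule tangentE)
  have prods: "p * q \<in> level_ideal" if "p \<in> level_ideal" for p q
    using ring_mod.subspace_scale[OF I that, of q] by (simp add: mult.commute)
  show ?thesis
  proof (rule tangentI[OF mult[OF N inv[OF N']]])
    have "(a * (1 - r * x' + d') + d' * (1 + r * x)) + ((r * r) * (- x * x' - y * z') - (b * (r * z' + c') + c' * (r * y))) \<in> level_ideal"
      by (intro ring_mod.subspace_add[OF I] ring_mod.subspace_diff[OF I] prods m m' rr)
    then show "(1 + r * x + a) * (1 - r * x' + d') + (r * y + b) * - (r * z' + c') - (1 + r * (x - x')) \<in> level_ideal"
      by (rule back_subst[of "\<lambda>t. t \<in> level_ideal"]) (simp add: algebra_simps)
    have "(b * (1 + r * x' + a') + a' * (r * y)) + ((r * r) * (y * x' - x * y') - (a * (r * y' + b') + b' * (1 + r * x))) \<in> level_ideal"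
      by (intro ring_mod.subspace_add[OF I] ring_mod.subspace_diff[OF I] prods m m' rr)
    then show "(1 + r * x + a) * - (r * y' + b') + (r * y + b) * (1 + r * x' + a') - r * (y - y') \<in> level_ideal"
      by (rule back_subst[of "\<lambda>t. t \<in> level_ideal"]) (simp add: algebra_simps)
    have "(c * (1 - r * x' + d') + d' * (r * z)) + ((r * r) * (x * z' - z * x') - (d * (r * z' + c') + c' * (1 - r * x))) \<in> level_ideal"
      by (intro ring_mod.subspace_add[OF I] ring_mod.subspace_diff[OF I] prods m m' rr)
    then show "(r * z + c) * (1 - r * x' + d') + (1 - r * x + d) * - (r * z' + c') - r * (z - z') \<in> level_ideal"
      by (rule back_subst[of "\<lambda>t. t \<in> level_ideal"]) (simp add: algebra_simps)
    have "(d * (1 + r * x' + a') + a' * (1 - r * x)) + ((r * r) * (- x * x' - z * y') - (c * (r * y' + b') + b' * (r * z))) \<in> level_ideal"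
      by (intro ring_mod.subspace_add[OF I] ring_mod.subspace_diff[OF I] prods m m' rr)
    then show "(r * z + c) * - (r * y' + b') + (1 - r * x + d) * (1 + r * x' + a') - (1 - r * (x - x')) \<in> level_ideal"
      by (rule back_subst[of "\<lambda>t. t \<in> level_ideal"]) (simp add: algebra_simps)
  qed
qed

text \<open>Conjugation is linear and fixes the identity, so it acts on tangent vectors by the
  adjoint action.\<close>

lemma tangent_conj_upper:
  assumes "tangent r x y z"
  shows "tangent r (x + t * z) (y - 2 * t * x - t\<^sup>2 * z) z"
proof -
  obtain a b c d where N: "N (1 + r * x + a) (r * y + b) (r * z + c) (1 - r * x + d)"
    and m: "a \<in> level_ideal" "b \<in> level_ideal" "c \<in> level_ideal" "d \<in> level_ideal"
    using assms by (rule tangentE)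
  show ?thesis
  proof (rule tangentI[OF conj_upper[OF N, of t]])
    show "1 + r * x + a + t * (r * z + c) - (1 + r * (x + t * z)) \<in> level_ideal"
      by (rule ideal_lin4[OF is_ideal_level_ideal m, of _ 1 0 t 0])
        (simp add: algebra_simps power2_eq_square)
    show "r * y + b + t * (1 - r * x + d) - t * (1 + r * x + a) - t\<^sup>2 * (r * z + c) - r * (y - 2 * t * x - t\<^sup>2 * z) \<in> level_ideal"
      by (rule ideal_lin4[OF is_ideal_level_ideal m, of _ "- t" 1 "- (t\<^sup>2)" t])
        (simp add: algebra_simps power2_eq_square)
    show "r * z + c - r * z \<in> level_ideal"
      by (rule ideal_lin4[OF is_ideal_level_ideal m, of _ 0 0 1 0])
        (simp add: algebra_simps power2_eq_square)
    show "1 - r * x + d - t * (r * z + c) - (1 - r * (x + t * z)) \<in> level_ideal"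
      by (rule ideal_lin4[OF is_ideal_level_ideal m, of _ 0 0 "- t" 1])
        (simp add: algebra_simps power2_eq_square)
  qed
qed

lemma tangent_conj_lower:
  assumes "tangent r x y z"
  shows "tangent r (x - t * y) y (z + 2 * t * x - t\<^sup>2 * y)"
proof -
  obtain a b c d where N: "N (1 + r * x + a) (r * y + b) (r * z + c) (1 - r * x + d)"
    and m: "a \<in> level_ideal" "b \<in> level_ideal" "c \<in> level_ideal" "d \<in> level_ideal"
    using assms by (rule tangentE)
  show ?thesis
  proof (rule tangentI[OF conj_lower[OF N, of t]])
    show "1 + r * x + a - t * (r * y + b) - (1 + r * (x - t * y)) \<in> level_ideal"
      by (rule ideal_lin4[OF is_ideal_level_ideal m, of _ 1 "- t" 0 0])
        (simp add: algebra_simps power2_eq_square)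
    show "r * y + b - r * y \<in> level_ideal"
      by (rule ideal_lin4[OF is_ideal_level_ideal m, of _ 0 1 0 0])
        (simp add: algebra_simps power2_eq_square)
    show "r * z + c + t * (1 + r * x + a) - t * (1 - r * x + d) - t\<^sup>2 * (r * y + b) - r * (z + 2 * t * x - t\<^sup>2 * y) \<in> level_ideal"
      by (rule ideal_lin4[OF is_ideal_level_ideal m, of _ t "- (t\<^sup>2)" 1 "- t"])
        (simp add: algebra_simps power2_eq_square)
    show "1 - r * x + d + t * (r * y + b) - (1 - r * (x - t * y)) \<in> level_ideal"
      by (rule ideal_lin4[OF is_ideal_level_ideal m, of _ 0 t 0 1])
        (simp add: algebra_simps power2_eq_square)
  qed
qed

text \<open>Successive commutators with the lower unipotent with entry d and twice with the upper
  unipotent with entry 1 take the tangent vector of the upper unipotent to -2 d^2 times itself.\<close>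

lemma upper_square_scale:
  assumes Q: "contains_principal level_ideal" and r: "N 1 r 0 1"
    and rr: "r * r \<in> level_ideal" and r3: "3 * r \<in> level_ideal"
  shows "N 1 (d\<^sup>2 * r) 0 1"
proof -
  note I = is_ideal_level_ideal
  have v0: "tangent r 0 1 0"
    by (rule tangentI[OF r]) (simp_all add: ring_mod.subspace_0[OF I])
  have v1: "tangent r d 0 (d\<^sup>2)"
    using tangent_diff[OF rr v0 tangent_conj_lower[OF v0, of d]] by simp
  have v2: "tangent r (- (d\<^sup>2)) (2 * d + d\<^sup>2) 0"
    using tangent_diff[OF rr v1 tangent_conj_upper[OF v1, of 1]] by (simp add: add.commute)
  have v3: "tangent r 0 (- 2 * d\<^sup>2) 0"
    using tangent_diff[OF rr v2 tangent_conj_upper[OF v2, of 1]] by simp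
  then obtain a b c e where N: "N (1 + r * 0 + a) (r * (- 2 * d\<^sup>2) + b) (r * 0 + c) (1 - r * 0 + e)"
    and m: "a \<in> level_ideal" "b \<in> level_ideal" "c \<in> level_ideal" "e \<in> level_ideal"
    by (rule tangentE)
  have "N 1 (r * (- 2 * d\<^sup>2)) 0 1"
    by (rule cong_closed[OF I Q N]) (use m ring_mod.subspace_neg[OF I] in simp_all)
  \<comment> \<open>Adding \<open>3 * d\<^sup>2 * r\<close>, which is in the level, turns the factor
    -2 into 1.\<close>
  moreover have "d\<^sup>2 * (3 * r) \<in> level_ideal"
    by (rule ring_mod.subspace_scale[OF I r3])
  ultimately have "N 1 (r * (- 2 * d\<^sup>2) + d\<^sup>2 * (3 * r)) 0 1"
    using upper_add level_ideal_upper by blast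
  then show ?thesis
    by (simp add: algebra_simps)
qed

text \<open>The assumptions \<open>two\<close> and \<open>sq\<close> are the two halves of Condition
  L, expressed at the primes over the level.\<close>

theorem upper_imp_level_ideal:
  assumes Q: "level_ideal \<noteq> {0}" "contains_principal level_ideal"
    and two: "\<And>P. is_prime P \<Longrightarrow> level_ideal \<subseteq> P \<Longrightarrow> 2 \<notin> P"
    and sq: "\<And>P. is_prime P \<Longrightarrow> level_ideal \<subseteq> P \<Longrightarrow> norm_three P \<Longrightarrow> level_ideal \<subseteq> P \<star> P"
    and r: "N 1 r 0 1"
  shows "r \<in> level_ideal"
proof -
  note I = is_ideal_level_ideal
  have "r * r \<in> level_ideal"
    using three_radical_times_upper[OF Q r two upper_in_three_radical[OF Q r two sq]] .
  moreover have "3 \<in> P" if P: "is_prime P" "level_ideal \<subseteq> P" "norm_three P" for P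
  proof -
    have "2 \<in> P \<or> 2 - 1 \<in> P \<or> 2 + 1 \<in> P"
      using P(3) unfolding norm_three_def by blast
    then show ?thesis
      using two[OF P(1,2)] P(1) by (simp add: is_prime_def)
  qed
  then have "3 \<in> three_radical"
    unfolding three_radical_def by blast
  then have r3: "3 * r \<in> level_ideal"
    using three_radical_times_upper[OF Q r two] by blast
  ultimately have square: "N 1 (d\<^sup>2 * r) 0 1" for d
    using upper_square_scale[OF Q(2) r] by blast
  have "N 1 (r * d) 0 1" for d
  proof -
    have "N 1 ((d + 1)\<^sup>2 * r - (d - 1)\<^sup>2 * r) 0 1"
      by (intro upper_diff square)
    moreover have "d * (3 * r) \<in> level_ideal"
      by (rule ring_mod.subspace_scale[OF I r3])
    \<comment> \<open>The difference of squares is \<open>4 * d * r\<close>; removing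
      \<open>3 * d * r\<close> leaves \<open>d * r\<close>.\<close>
    ultimately have "N 1 (((d + 1)\<^sup>2 * r - (d - 1)\<^sup>2 * r) - d * (3 * r)) 0 1"
      using upper_diff level_ideal_upper by blast
    then show ?thesis
      by (simp add: algebra_simps power2_eq_square)
  qed
  then show ?thesis
    by (simp add: level_ideal_def)
qed

end

text \<open>With numeral indices, \<open>$\<close> would be ambiguous between vectors and power series.\<close>

no_notation fps_nth (infixl \<open>$\<close> 75)

section \<open>The special linear group of degree two\<close>

definition mat22 :: "'a::comm_ring_1 \<Rightarrow> 'a \<Rightarrow> 'a \<Rightarrow> 'a \<Rightarrow> 'a ^ 2 ^ 2"
  where "mat22 a b c d = vector [vector [a, b], vector [c, d]]"

lemma mat22_nth [simp]:
  "mat22 a b c d $ 1 $ 1 = a" "mat22 a b c d $ 1 $ 2 = b"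
  "mat22 a b c d $ 2 $ 1 = c" "mat22 a b c d $ 2 $ 2 = d"
  by (simp_all add: mat22_def)

lemma mat22_eqI:
  assumes "A $ 1 $ 1 = B $ 1 $ 1" "A $ 1 $ 2 = B $ 1 $ 2" "A $ 2 $ 1 = B $ 2 $ 1" "A $ 2 $ 2 = B $ 2 $ 2"
  shows "A = (B :: 'a::comm_ring_1 ^ 2 ^ 2)"
  using assms by (simp add: vec_eq_iff forall_2)

lemma mat22_cases:
  obtains a b c d where "A = mat22 a b c (d :: 'a::comm_ring_1)"
proof -
  have "A = mat22 (A $ 1 $ 1) (A $ 1 $ 2) (A $ 2 $ 1) (A $ 2 $ 2)"
    by (rule mat22_eqI) simp_all
  then show ?thesis
    by (rule that)
qed

lemma mat22_mult:
  "mat22 a b c d ** mat22 a' b' c' d' =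
    mat22 (a * a' + b * c') (a * b' + b * d') (c * a' + d * c') (c * b' + d * (d' :: 'a::comm_ring_1))"
  by (rule mat22_eqI) (simp_all add: matrix_matrix_mult_def sum_2)

lemma mat_1_eq_mat22: "mat 1 = mat22 1 0 0 (1 :: 'a::comm_ring_1)"
  by (rule mat22_eqI) (simp_all add: mat_def)

lemma T_mat_eq_mat22: "T_mat r = mat22 1 r 0 1"
  by (simp add: T_mat_def mat22_def)

lemma SL2_simps:
  "mat22 a b c d \<in> carrier SL2 \<longleftrightarrow> a * d - b * c = (1 :: 'a::comm_ring_1)"
  "monoid.mult SL2 = (\<lambda>A B :: 'a ^ 2 ^ 2. A ** B)"
  "monoid.one SL2 = (mat 1 :: 'a ^ 2 ^ 2)"
  by (simp_all add: SL2_def det_2)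

lemma group_SL2: "group (SL2 :: ('a::comm_ring_1 ^ 2 ^ 2) monoid)"
proof (rule groupI)
  show "\<exists>B\<in>carrier SL2. B \<otimes>\<^bsub>SL2\<^esub> A = \<one>\<^bsub>SL2\<^esub>" if "A \<in> carrier SL2" for A :: "'a ^ 2 ^ 2"
  proof -
    obtain a b c d where A: "A = mat22 a b c d"
      by (rule mat22_cases)
    have "mat22 d (- b) (- c) a \<in> carrier SL2" "mat22 d (- b) (- c) a ** A = mat 1"
      using that unfolding A by (simp_all add: SL2_simps mat22_mult mat_1_eq_mat22 algebra_simps)
    then show ?thesis
      by (auto simp: SL2_simps)
  qed
qed (auto simp: SL2_def det_mul matrix_mul_assoc)

interpretation SL2: group "SL2 :: ('a::comm_ring_1 ^ 2 ^ 2) monoid"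
  by (rule group_SL2)

lemma inv_mat22:
  assumes "a * d - b * c = (1 :: 'a::comm_ring_1)"
  shows "inv\<^bsub>SL2\<^esub> (mat22 a b c d) = mat22 d (- b) (- c) a"
proof (rule SL2.inv_equality)
  show "mat22 d (- b) (- c) a \<otimes>\<^bsub>SL2\<^esub> mat22 a b c d = \<one>\<^bsub>SL2\<^esub>"
    using assms by (simp add: SL2_simps mat22_mult mat_1_eq_mat22 algebra_simps)
qed (use assms in \<open>simp_all add: SL2_simps algebra_simps\<close>)

section \<open>The core of a subgroup\<close>

text \<open>The normal core, with conjugates written exactly as in \<open>quasi_level\<close>, so
  that the quasi-level is read off from the upper unipotents in the core.\<close>

definition core :: "('b, 'c) monoid_scheme \<Rightarrow> 'b set \<Rightarrow> 'b set"
  where "core G H = {x \<in> carrier G. \<forall>g\<in>carrier G. x \<in> (g <#\<^bsub>G\<^esub> H) #>\<^bsub>G\<^esub> inv\<^bsub>G\<^esub> g}"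

context group
begin

lemma mem_conjugate_iff:
  assumes H: "subgroup H G" and x: "x \<in> carrier G" and g: "g \<in> carrier G"
  shows "x \<in> (g <# H) #> inv g \<longleftrightarrow> inv g \<otimes> x \<otimes> g \<in> H"
proof
  assume "x \<in> (g <# H) #> inv g"
  then obtain h where h: "h \<in> H" "x = g \<otimes> h \<otimes> inv g"
    by (auto simp: l_coset_def r_coset_def)
  have "h \<in> carrier G"
    using subgroup.mem_carrier[OF H h(1)] .
  then have "inv g \<otimes> x \<otimes> g = h"
    using g h(2) by (simp add: m_assoc) (simp add: m_assoc[symmetric])
  then show "inv g \<otimes> x \<otimes> g \<in> H"
    using h(1) by simp
next
  assume h: "inv g \<otimes> x \<otimes> g \<in> H"
  have "x = g \<otimes> (inv g \<otimes> x \<otimes> g) \<otimes> inv g"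
    using g x by (simp add: m_assoc) (simp add: m_assoc[symmetric])
  then show "x \<in> (g <# H) #> inv g"
    using h by (auto simp: l_coset_def r_coset_def)
qed

lemma core_iff:
  assumes "subgroup H G"
  shows "x \<in> core G H \<longleftrightarrow> x \<in> carrier G \<and> (\<forall>g\<in>carrier G. inv g \<otimes> x \<otimes> g \<in> H)"
  using mem_conjugate_iff[OF assms] by (auto simp: core_def)

lemma core_one: "subgroup H G \<Longrightarrow> \<one> \<in> core G H"
  by (simp add: core_iff subgroup.one_closed)

lemma core_mult:
  assumes H: "subgroup H G" and x: "x \<in> core G H" and y: "y \<in> core G H"
  shows "x \<otimes> y \<in> core G H"
proof -
  have xy: "x \<in> carrier G" "y \<in> carrier G"
    using x y core_iff[OF H] by auto
  have "inv g \<otimes> (x \<otimes> y) \<otimes> g \<in> H" if g: "g \<in> carrier G" for g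
  proof -
    have "inv g \<otimes> (x \<otimes> y) \<otimes> g = (inv g \<otimes> x \<otimes> g) \<otimes> (inv g \<otimes> y \<otimes> g)"
      using xy g by (simp add: m_assoc) (simp add: m_assoc[symmetric])
    then show ?thesis
      using subgroup.m_closed[OF H] x y g core_iff[OF H] by metis
  qed
  then show ?thesis
    using xy core_iff[OF H] by blast
qed

lemma core_inv:
  assumes H: "subgroup H G" and x: "x \<in> core G H"
  shows "inv x \<in> core G H"
proof -
  have xc: "x \<in> carrier G"
    using x core_iff[OF H] by auto
  have "inv g \<otimes> inv x \<otimes> g \<in> H" if g: "g \<in> carrier G" for g
  proof -
    have "inv (inv g \<otimes> x \<otimes> g) = inv g \<otimes> inv x \<otimes> g"
      using xc g by (simp add: inv_mult_group m_assoc)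
    then show ?thesis
      using subgroup.m_inv_closed[OF H] x g core_iff[OF H] by metis
  qed
  then show ?thesis
    using xc core_iff[OF H] by blast
qed

lemma core_conj:
  assumes H: "subgroup H G" and x: "x \<in> core G H" and k: "k \<in> carrier G"
  shows "k \<otimes> x \<otimes> inv k \<in> core G H"
proof -
  have xc: "x \<in> carrier G"
    using x core_iff[OF H] by auto
  have "inv g \<otimes> (k \<otimes> x \<otimes> inv k) \<otimes> g \<in> H" if g: "g \<in> carrier G" for g
  proof -
    have "inv g \<otimes> (k \<otimes> x \<otimes> inv k) \<otimes> g = inv (inv k \<otimes> g) \<otimes> x \<otimes> (inv k \<otimes> g)"
      using xc g k by (simp add: inv_mult_group m_assoc)
    then show ?thesis
      using x g k core_iff[OF H] by (metis inv_closed m_closed)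
  qed
  then show ?thesis
    using xc k core_iff[OF H] by blast
qed

end

section \<open>Principal congruence subgroups and the core in matrix entries\<close>

lemma SL2_principal_mat22:
  "mat22 a b c d \<in> SL2_principal I \<longleftrightarrow>
    a * d - b * c = 1 \<and> a - 1 \<in> I \<and> b \<in> I \<and> c \<in> I \<and> d - 1 \<in> I"
  by (auto simp: SL2_principal_def SL2_simps forall_2 mat_1_eq_mat22)

lemma SL2_principal_conj:
  assumes I: "is_ideal I" and A: "A \<in> SL2_principal I" and g: "g \<in> carrier SL2"
  shows "inv\<^bsub>SL2\<^esub> g \<otimes>\<^bsub>SL2\<^esub> A \<otimes>\<^bsub>SL2\<^esub> g \<in> SL2_principal I"
proof -
  obtain a b c d where A_eq: "A = mat22 a b c d"
    by (rule mat22_cases)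
  obtain p q r s where g_eq: "g = mat22 p q r s"
    by (rule mat22_cases)
  have m: "a - 1 \<in> I" "b \<in> I" "c \<in> I" "d - 1 \<in> I"
    using A unfolding A_eq SL2_principal_mat22 by auto
  have pq: "p * s - q * r = 1"
    using g unfolding g_eq SL2_simps .
  have "A \<in> carrier SL2"
    using A by (simp add: SL2_principal_def)
  then have "inv\<^bsub>SL2\<^esub> g \<otimes>\<^bsub>SL2\<^esub> A \<otimes>\<^bsub>SL2\<^esub> g \<in> carrier SL2"
    using g by (intro SL2.m_closed SL2.inv_closed)
  moreover have eq: "inv\<^bsub>SL2\<^esub> g \<otimes>\<^bsub>SL2\<^esub> A \<otimes>\<^bsub>SL2\<^esub> g =
    mat22 ((s * a + - q * c) * p + (s * b + - q * d) * r) ((s * a + - q * c) * q + (s * b + - q * d) * s)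
      ((- r * a + p * c) * p + (- r * b + p * d) * r) ((- r * a + p * c) * q + (- r * b + p * d) * s)"
    unfolding g_eq A_eq inv_mat22[OF pq] SL2_simps mat22_mult ..
  moreover have "(s * a + - q * c) * p + (s * b + - q * d) * r - 1 \<in> I"
    by (rule ideal_lin4[OF I m, of _ "s * p" "s * r" "- q * p" "- q * r"]) (use pq in \<open>simp add: algebra_simps\<close>)
  moreover have "(s * a + - q * c) * q + (s * b + - q * d) * s \<in> I"
    by (rule ideal_lin4[OF I m, of _ "s * q" "s * s" "- q * q" "- q * s"]) (simp add: algebra_simps)
  moreover have "(- r * a + p * c) * p + (- r * b + p * d) * r \<in> I"
    by (rule ideal_lin4[OF I m, of _ "- r * p" "- r * r" "p * p" "p * r"]) (simp add: algebra_simps)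
  moreover have "(- r * a + p * c) * q + (- r * b + p * d) * s - 1 \<in> I"
    by (rule ideal_lin4[OF I m, of _ "- r * q" "- r * s" "p * q" "p * s"]) (use pq in \<open>simp add: algebra_simps\<close>)
  ultimately show ?thesis
    by (simp add: SL2_principal_mat22 SL2_simps)
qed

text \<open>Principal congruence subgroups are normal, so the congruence property passes from
  \<open>H\<close> to its core.\<close>

lemma SL2_principal_subset_core:
  assumes "subgroup H SL2" "is_ideal I" "SL2_principal I \<subseteq> H"
  shows "SL2_principal I \<subseteq> core SL2 H"
proof
  fix A assume A: "A \<in> SL2_principal I"
  then have "inv\<^bsub>SL2\<^esub> g \<otimes>\<^bsub>SL2\<^esub> A \<otimes>\<^bsub>SL2\<^esub> g \<in> H" if "g \<in> carrier SL2" for g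
    using SL2_principal_conj[OF assms(2) A that] assms(3) by blast
  moreover have "A \<in> carrier SL2"
    using A by (simp add: SL2_principal_def)
  ultimately show "A \<in> core SL2 H"
    using SL2.core_iff[OF assms(1)] by blast
qed

lemma elementary_normal_core:
  assumes H: "subgroup H (SL2 :: ('a::idom ^ 2 ^ 2) monoid)"
  shows "elementary_normal (\<lambda>a b c d. mat22 a b c d \<in> core SL2 H)"
proof
  fix a b c d :: 'a
  assume N: "mat22 a b c d \<in> core SL2 H"
  then show det: "a * d - b * c = 1"
    using SL2.core_iff[OF H] SL2_simps by blast
  show "mat22 d (- b) (- c) a \<in> core SL2 H"
    using SL2.core_inv[OF H N] by (simp add: inv_mat22[OF det])
  show "mat22 (a * a' + b * c') (a * b' + b * d') (c * a' + d * c') (c * b' + d * d') \<in> core SL2 H"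
    if "mat22 a' b' c' d' \<in> core SL2 H" for a' b' c' d'
    using SL2.core_mult[OF H N that] by (simp add: SL2_simps mat22_mult)
  fix t :: 'a
  have "mat22 1 t 0 1 \<in> carrier SL2" "mat22 1 0 t 1 \<in> carrier SL2"
    by (simp_all add: SL2_simps)
  note conj = this[THEN SL2.core_conj[OF H N]]
  have "inv\<^bsub>SL2\<^esub> (mat22 1 t 0 1) = mat22 1 (- t) 0 1" "inv\<^bsub>SL2\<^esub> (mat22 1 0 t 1) = mat22 1 0 (- t) 1"
    by (simp_all add: inv_mat22)
  note conj' = conj[unfolded this SL2_simps mat22_mult]
  show "mat22 (a + t * c) (b + t * d - t * a - t\<^sup>2 * c) c (d - t * c) \<in> core SL2 H"
    using conj'(1) by (simp add: algebra_simps power2_eq_square)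
  show "mat22 (a - t * b) b (c + t * a - t * d - t\<^sup>2 * b) (d + t * b) \<in> core SL2 H"
    using conj'(2) by (simp add: algebra_simps power2_eq_square)
next
  show "mat22 1 0 0 1 \<in> core SL2 H"
    using SL2.core_one[OF H] by (simp add: SL2_simps mat_1_eq_mat22)
qed

lemma quasi_level_eq: "quasi_level H = {r. mat22 1 r 0 1 \<in> core SL2 H}"
  by (auto simp: quasi_level_def core_def T_mat_eq_mat22 SL2_simps)

theorem theoremB:
  fixes H :: "('a::idom ^ 2 ^ 2) set"
  assumes "dedekind_domain TYPE('a)"
    and "congruence_subgroup H"
    and "condition_L H"
  shows "quasi_level H = level H \<and> ideal (quasi_level H) \<D>"
proof -
  have H: "subgroup H SL2"
    using assms(2) by (simp add: congruence_subgroup_def)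
  obtain I where I: "is_ideal I" "I \<noteq> {0}" "SL2_principal I \<subseteq> H"
    using assms(2) by (auto simp: congruence_subgroup_def ideal_iff)
  define N where "N = (\<lambda>a b c d :: 'a. mat22 a b c d \<in> core SL2 H)"
  interpret dedekind_elementary_normal "TYPE('a)" N
    unfolding N_def by (intro dedekind_elementary_normal.intro dedekind.intro elementary_normal_core assms(1) H)
  have N_upper: "N 1 r 0 1 \<longleftrightarrow> r \<in> quasi_level H" for r
    by (simp add: N_def quasi_level_eq)
  have level: "level H = level_ideal"
    unfolding level_def
  proof (rule Greatest_equality)
    show "ideal level_ideal \<D> \<and> level_ideal \<subseteq> quasi_level H"
      using is_ideal_level_ideal level_ideal_upper by (auto simp: ideal_iff N_upper)
    show "J \<subseteq> level_ideal" if "ideal J \<D> \<and> J \<subseteq> quasi_level H" for J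
    proof
      fix x assume "x \<in> J"
      then have "x * d \<in> J" for d
        using that ring_mod.subspace_scale[of J x d] by (simp add: ideal_iff mult.commute)
      then show "x \<in> level_ideal"
        using that by (auto simp: level_ideal_def N_upper)
    qed
  qed
  have nz: "level_ideal \<noteq> {0}"
    and odd: "level_ideal <+>\<^bsub>\<D>\<^esub> PIdl\<^bsub>\<D>\<^esub> 2 = UNIV"
    and ord: "\<And>P. is_prime P \<Longrightarrow> card (carrier (\<D> Quot P)) = 3 \<Longrightarrow> ord_ideal P level_ideal \<noteq> 1"
    using assms(3) unfolding condition_L_def level primeideal_iff by auto
  have "contains_principal I"
    using SL2_principal_subset_core[OF H I(1,3)] SL2_principal_mat22[of _ _ _ _ I]
    unfolding contains_principal_def by (metis N_def subsetD)
  then have principal: "contains_principal level_ideal"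
    by (rule contains_principal_if_upper[OF I(1,2) _ is_ideal_level_ideal level_ideal_upper])
  have two: "2 \<notin> P" if P: "is_prime P" "level_ideal \<subseteq> P" for P
  proof
    assume "2 \<in> P"
    have idP: "is_ideal P"
      using P by (simp add: is_prime_def)
    have "1 \<in> level_ideal <+>\<^bsub>\<D>\<^esub> PIdl\<^bsub>\<D>\<^esub> (2 :: 'a)"
      using odd by simp
    then obtain x y where "x \<in> level_ideal" "1 = x + y * 2"
      by (auto simp: set_add_def' cgenideal_def)
    then have "1 \<in> P"
      using P(2) \<open>2 \<in> P\<close> ring_mod.subspace_add[OF idP] ring_mod.subspace_scale[OF idP] by (metis subsetD)
    then show False
      using P(1) by (simp add: is_prime_def)
  qed
  \<comment> \<open>Condition (ii) is used contrapositively: lying in \<open>P\<close> but not in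
    \<open>P \<star> P\<close> means order one, and norm three with 2 outside \<open>P\<close> means
    three cosets.\<close>
  have sq: "level_ideal \<subseteq> P \<star> P" if P: "is_prime P" "level_ideal \<subseteq> P" "norm_three P" for P
  proof (rule ccontr)
    assume "\<not> level_ideal \<subseteq> P \<star> P"
    then have "ord_ideal P level_ideal = 1"
      by (rule ord_ideal_eq_1[OF is_ideal_level_ideal nz P(1,2)])
    moreover have "card (carrier (\<D> Quot P)) = 3"
      using card_Quot_eq_3[OF P(1) two[OF P(1,2)]] P(3) by (simp add: norm_three_def)
    ultimately show False
      using ord P(1) by blast
  qed
  have "quasi_level H \<subseteq> level_ideal"
    using upper_imp_level_ideal[OF nz principal two sq] N_upper by blast
  moreover have "level_ideal \<subseteq> quasi_level H"
    using level_ideal_upper N_upper by blast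
  ultimately show ?thesis
    using is_ideal_level_ideal by (simp add: level ideal_iff)
qed

end
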